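(* Assume that $\mathbf{E}\,\xi=0$, $\mathbf{E}\,\xi^2=1$, that $V(t)=t^{-\alpha}L(t)$ with $\alpha>2$ and $L$ slowly varying at infinity, and that $M_n\gg s_n$ as $n\to\infty$. Then, for any fixed integer $k\ge2$, there is a positive sequence $\{h_{k,n}\}_{n\ge1}$ vanishing (slowly enough) as $n\to\infty$, i.e. $h_{k,n}\to 0$, such that $$\mathbf{P}(Y_n>x)\sim\frac{\Pi_n^k}{k!}\sum_{j=0}^k\binom{k}{j}W_{k-j}(x/M_n-j),\quad n\to\infty,$$ uniformly in $x\in((k-1+h_{k,n})M_n,\,(k-h_{k,n})M_n)$.
   Context: Let $\xi,\xi_1,\xi_2,\ldots$ be independent identically distributed real random variables, with right distribution tail $V(t):=\mathbf{P}(\xi>t)$. A function $L$ is slowly varying at infinity if for any $y>0$ one has $L(ty)/L(t)\to1$ as $t\to\infty$. Put $s_n:=((\alpha-2)n\ln n)^{1/2}$, $n\ge1$. Let $\{M_n\}_{n\ge 1}$ be a (deterministic) threshold sequence, and define the sums of censored variables $$Y_n:=\sum_{j=1}^n(\xi_j\wedge M_n),\quad n\ge1,$$ where $a\wedge b=\min(a,b)$. Put $\Pi_n:=nV(M_n)$, $n\ge1$. For $m\ge1$ and $z\in(m-1,m)$ introduce the simplex $$D_m(z):=\Big\{\boldsymbol{t}=(t_1,\ldots,t_m)\in\mathbb{R}^m:\ \max_{1\le j\le m}t_j<1,\ t_1+\cdots+t_m>z\Big\}$$ and the function $$W_m(z):=\alpha^m\int_{D_m(z)}(t_1\cdots t_m)^{-\alpha-1}\,d\boldsymbol{t},\quad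 z\in(m-1,m);$$ also set $W_0(z)\equiv1$. Notation: $a_n\gg b_n$ means $b_n/a_n\to0$ (so $M_n\gg s_n$ means $s_n/M_n\to 0$ with $M_n>0$ for large $n$); $f\sim g$ means $f/g\to1$; "$f_n(x)\sim g_n(x)$ uniformly in $x\in I_n$" means $\sup_{x\in I_n}|f_n(x)/g_n(x)-1|\to0$ as $n\to\infty$. *)

theory Defs
  imports "HOL-Probability.Probability"
begin

definition slowly_varying :: "(real \<Rightarrow> real) \<Rightarrow> bool" where
  "slowly_varying L \<longleftrightarrow> (\<forall>y>0. ((\<lambda>t. L (t * y) / L t) \<longlongrightarrow> 1) at_top)"

definition right_tail :: "'a measure \<Rightarrow> ('a \<Rightarrow> real) \<Rightarrow> real \<Rightarrow> real" where
  "right_tail P X t = measure P {\<omega> \<in> space P. X \<omega> > t}"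

definition s_seq :: "real \<Rightarrow> nat \<Rightarrow> real" where
  "s_seq \<alpha> n = sqrt ((\<alpha> - 2) * real n * ln (real n))"

definition dominates :: "(nat \<Rightarrow> real) \<Rightarrow> (nat \<Rightarrow> real) \<Rightarrow> bool" where
  "dominates M s \<longleftrightarrow> (\<forall>\<^sub>F n in sequentially. M n > 0) \<and> (\<lambda>n. s n / M n) \<longlonglongrightarrow> 0"

definition censored_sum :: "(nat \<Rightarrow> 'a \<Rightarrow> real) \<Rightarrow> (nat \<Rightarrow> real) \<Rightarrow> nat \<Rightarrow> 'a \<Rightarrow> real" where
  "censored_sum \<xi> M n \<omega> = (\<Sum>j=1..n. min (\<xi> j \<omega>) (M n))"

text \<open>Since the dimension \<open>m\<close> varies, \<open>\<real>\<^sup>m\<close> is the space of the product measure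
  of \<open>m\<close> copies of \<^term>\<open>lborel\<close>: functions on \<open>{1..m}\<close>, \<^const>\<open>undefined\<close> elsewhere.\<close>

abbreviation lborel_pow :: "nat \<Rightarrow> (nat \<Rightarrow> real) measure" where
  "lborel_pow m \<equiv> Pi\<^sub>M {1..m} (\<lambda>_. lborel)"

definition D_simplex :: "nat \<Rightarrow> real \<Rightarrow> (nat \<Rightarrow> real) set" where
  "D_simplex m z =
     {t \<in> space (lborel_pow m). (\<forall>j\<in>{1..m}. t j < 1) \<and> (\<Sum>j=1..m. t j) > z}"

text \<open>For \<open>m \<ge> 1\<close> this is meaningful only for \<open>z \<in> (m - 1, m)\<close>: there every coordinate of a point
  of \<^term>\<open>D_simplex m z\<close> exceeds \<open>z - (m - 1) > 0\<close>, so the integrand is bounded and \<open>powr\<close> has a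
  positive base. Values at other \<open>z\<close> carry no meaning.\<close>

definition W_fun :: "real \<Rightarrow> nat \<Rightarrow> real \<Rightarrow> real" where
  "W_fun \<alpha> m z =
     (if m = 0 then 1
      else \<alpha> ^ m * (LINT t:D_simplex m z|lborel_pow m. (\<Prod>j=1..m. t j) powr (- \<alpha> - 1)))"

text \<open>The supremum is taken in \<^typ>\<open>ennreal\<close>, where it exists for unbounded and for empty index sets.\<close>

definition unif_equiv ::
  "(nat \<Rightarrow> real \<Rightarrow> real) \<Rightarrow> (nat \<Rightarrow> real \<Rightarrow> real) \<Rightarrow> (nat \<Rightarrow> real set) \<Rightarrow> bool" where
  "unif_equiv f g I \<longleftrightarrow>
     (\<lambda>n. SUP x\<in>I n. ennreal \<bar>f n x / g n x - 1\<bar>) \<longlonglongrightarrow> 0"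

end

theory Submission
  imports Defs
begin

text \<open>
  The event \<open>Y\<^sub>n > x\<close> with \<open>x = z M\<^sub>n\<close>, \<open>k - 1 < z < k\<close>, is caused by exactly \<open>k\<close> big jumps.  A
  censored summand contributes at most \<open>M\<^sub>n\<close>, and \<open>M\<^sub>n\<close> is so large compared with \<open>s\<^sub>n\<close> that the
  summands below \<open>\<delta> M\<^sub>n\<close> cannot, up to a probability of smaller order than \<open>\<Pi>\<^sub>n\<^sup>k\<close>, add up to the missing
  \<open>(z - k + 1) M\<^sub>n\<close>; so fewer than \<open>k\<close> jumps above \<open>\<delta> M\<^sub>n\<close> do not suffice
  (\<open>few_jumps_negligible\<close>, an exponential moment bound).  More than \<open>k\<close> such jumps have probability at most of order
  \<open>\<Pi>\<^sub>n\<^sup>k\<^sup>+\<^sup>1\<close>.  When there are exactly \<open>k\<close> of them, the remaining sum is of order \<open>\<surd>n\<close>, negligible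
  against \<open>M\<^sub>n\<close>, and only the \<open>k\<close> jumps count (\<open>prob_censored_sum_le\<close>, \<open>prob_censored_sum_ge\<close>).

  Given that it exceeds \<open>\<delta> M\<^sub>n\<close>, a jump divided by \<open>M\<^sub>n\<close> is in the limit Pareto distributed on
  \<open>(\<delta>, \<infinity>)\<close>, by regular variation.  Hence the sum of the \<open>k\<close> censored jumps converges in law to the
  \<open>k\<close>-fold convolution of the Pareto law clipped at \<open>1\<close> (\<open>big_jump_sum_limit\<close>, by characteristic functions).
  The clipped law has an atom at \<open>1\<close> and a density below; expanding the convolution according to the
  number \<open>j\<close> of factors sitting in the atom gives \<open>\<Sum>\<^sub>j (k choose j) W\<^sub>k\<^sub>-\<^sub>j(z - j)\<close>
  (\<open>measure_pareto_sum_tail\<close>).  Since every coordinate of a point of the simplex \<open>D\<^sub>m(z)\<close> exceeds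
  \<open>z - m + 1\<close>, the cut-off \<open>\<delta>\<close> leaves no trace once it is small.

  This is convergence for one fixed \<open>z\<close>.  The probability is monotone in \<open>z\<close> and the limit is continuous on
  \<open>(k - 1, k)\<close>, so the convergence is uniform on compact subintervals
  (\<open>antimono_pointwise_imp_uniform_limit\<close>); as the limit is at least \<open>1\<close>, the ratio
  then tends to \<open>1\<close> uniformly as well.  A diagonal
  choice lets the compact subintervals exhaust \<open>(k - 1, k)\<close> slowly (\<open>slowly_vanishing_parameter\<close>).
\<close>

section \<open>Elementary real analysis\<close>

lemma exp_le_quadratic:
  fixes x :: real
  assumes "x \<le> 1"
  shows "exp x \<le> 1 + x + x\<^sup>2"
proof (cases "0 \<le> x")
  case True
  then show ?thesis using exp_bound assms by simp
next
  case False
  have "exp x * (1 - x) \<le> 1"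
    using exp_ge_add_one_self[of "-x"] mult_left_mono[of "1 - x" "exp (-x)" "exp x"]
    by (simp add: exp_minus)
  also have "1 \<le> (1 + x + x\<^sup>2) * (1 - x)"
  proof -
    have "(1 + x + x\<^sup>2) * (1 - x) = 1 + (- x) ^ 3"
      by (simp add: power2_eq_square power3_eq_cube algebra_simps)
    moreover have "(- x) ^ 3 \<ge> 0" using False by simp
    ultimately show ?thesis by linarith
  qed
  finally show ?thesis using False by simp
qed

text \<open>Polya's argument: on a fine finite grid the convergence is uniform, and between two grid points monotonicity
  sandwiches \<open>F n\<close>, while uniform continuity makes the oscillation of \<open>G\<close> small.\<close>

lemma antimono_pointwise_imp_uniform_limit:
  fixes F :: "nat \<Rightarrow> real \<Rightarrow> real"
  assumes anti: "\<forall>\<^sub>F n in sequentially. antimono (F n)"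
    and lim: "\<And>z. z \<in> {c..d} \<Longrightarrow> (\<lambda>n. F n z) \<longlonglongrightarrow> G z"
    and cont: "continuous_on {c..d} G" and "c < d"
  shows "uniform_limit {c..d} F G sequentially"
proof (rule uniform_limitI)
  fix e :: real assume "e > 0"
  have "uniformly_continuous_on {c..d} G"
    using cont by (rule compact_uniformly_continuous) simp
  then obtain r where r: "r > 0" and
    rG: "\<And>x y. x \<in> {c..d} \<Longrightarrow> y \<in> {c..d} \<Longrightarrow> \<bar>x - y\<bar> < r \<Longrightarrow> \<bar>G x - G y\<bar> < e / 2"
    unfolding uniformly_continuous_on_def dist_real_def using \<open>e > 0\<close>
    by (metis half_gt_zero)
  obtain N :: nat where N: "(d - c) / r < real N" using reals_Archimedean2 by blast
  have "N > 0" using N \<open>c < d\<close> r by (cases N) (auto simp: field_simps)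
  define w where "w = (d - c) / real N"
  have w: "0 < w" "w < r" "real N * w = d - c"
    using N \<open>c < d\<close> r \<open>N > 0\<close> by (auto simp: w_def field_simps)
  define p where "p i = c + real i * w" for i
  have p_in: "p i \<in> {c..d}" if "i \<le> N" for i
  proof -
    have "real i * w \<le> real N * w" using that w by (intro mult_right_mono) auto
    then show ?thesis using w by (auto simp: p_def)
  qed
  have "\<forall>\<^sub>F n in sequentially. \<forall>i\<in>{..N}. \<bar>F n (p i) - G (p i)\<bar> < e / 2"
  proof (intro eventually_ball_finite ballI)
    fix i assume "i \<in> {..N}"
    then show "\<forall>\<^sub>F n in sequentially. \<bar>F n (p i) - G (p i)\<bar> < e / 2"
      using tendstoD[OF lim[OF p_in], of i "e / 2"] \<open>e > 0\<close> by (simp add: dist_real_def)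
  qed simp
  with anti show "\<forall>\<^sub>F n in sequentially. \<forall>z\<in>{c..d}. dist (F n z) (G z) < e"
  proof eventually_elim
    case (elim n)
    show ?case
    proof
      fix z assume z: "z \<in> {c..d}"
      show "dist (F n z) (G z) < e"
      proof (cases "z = d")
        case True
        have "p N = d" using w by (simp add: p_def)
        moreover have "\<bar>F n (p N) - G (p N)\<bar> < e / 2" using elim(2) by simp
        ultimately show ?thesis using True \<open>e > 0\<close> by (simp add: dist_real_def)
      next
        case False
        define i where "i = nat \<lfloor>(z - c) / w\<rfloor>"
        have ge: "(z - c) / w \<ge> 0" using z w by auto
        have i: "real i \<le> (z - c) / w" "(z - c) / w < real i + 1"
          using ge by (auto simp: i_def)
        have zi: "p i \<le> z" "z < p (Suc i)"
          using i w by (auto simp: p_def field_simps)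
        have "(z - c) / w < real N" using False z w by (auto simp: field_simps)
        then have "Suc i \<le> N" using i by linarith
        then have pin: "p i \<in> {c..d}" "p (Suc i) \<in> {c..d}" using p_in by auto
        have step: "p (Suc i) - p i = w" by (simp add: p_def algebra_simps)
        have "F n z \<le> F n (p i)" "F n (p (Suc i)) \<le> F n z"
          using elim(1) zi by (auto simp: antimono_def)
        moreover have "\<bar>F n (p i) - G (p i)\<bar> < e / 2" "\<bar>F n (p (Suc i)) - G (p (Suc i))\<bar> < e / 2"
          using elim(2) \<open>Suc i \<le> N\<close> by auto
        moreover have "\<bar>G z - G (p i)\<bar> < e / 2" "\<bar>G z - G (p (Suc i))\<bar> < e / 2"
          using zi step w by (intro rG z pin; simp)+
        ultimately show ?thesis unfolding dist_real_def by linarith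
      qed
    qed
  qed
qed

text \<open>Take for \<open>h n\<close> the smallest of the values \<open>1 / (i + 1)\<close>, \<open>i \<le> n\<close>, for which the property already holds at
  \<open>n\<close>; every such value is reached from some \<open>n\<close> on.\<close>

lemma slowly_vanishing_parameter:
  fixes A :: "real \<Rightarrow> nat \<Rightarrow> bool"
  assumes A: "\<And>e. e > 0 \<Longrightarrow> eventually (A e) sequentially"
  obtains h :: "nat \<Rightarrow> real" where "\<And>n. h n > 0" "h \<longlonglongrightarrow> 0" "\<forall>\<^sub>F n in sequentially. A (h n) n"
proof -
  define S where "S n = {i. i \<le> n \<and> A (1 / real (Suc i)) n}" for n
  define h where "h n = 1 / real (Suc (if S n = {} then 0 else Max (S n)))" for n
  have fin: "finite (S n)" for n by (rule finite_subset[of _ "{..n}"]) (auto simp: S_def)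
  have evS: "\<forall>\<^sub>F n in sequentially. i \<in> S n" for i
  proof -
    have "eventually (A (1 / real (Suc i))) sequentially" by (intro A) simp
    then show ?thesis using eventually_ge_at_top[of i]
      by eventually_elim (auto simp: S_def)
  qed
  have "\<forall>\<^sub>F n in sequentially. A (h n) n"
    using evS[of 0]
  proof eventually_elim
    case (elim n)
    then have "Max (S n) \<in> S n" using fin by (intro Max_in) auto
    then show ?case using elim by (auto simp: S_def h_def)
  qed
  moreover have "h \<longlonglongrightarrow> 0"
  proof (rule LIMSEQ_I)
    fix r :: real assume "r > 0"
    then obtain i where i: "1 / real (Suc i) < r" using nat_approx_posE by blast
    obtain n0 where n0: "\<And>n. n \<ge> n0 \<Longrightarrow> i \<in> S n"
      using evS[of i] by (auto simp: eventually_sequentially)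
    have "norm (h n - 0) < r" if "n \<ge> n0" for n
    proof -
      have "i \<le> Max (S n)" using n0[OF that] fin by auto
      then have "1 / real (Suc (Max (S n))) \<le> 1 / real (Suc i)" by (intro divide_left_mono) auto
      then show ?thesis using i n0[OF that] by (auto simp: h_def)
    qed
    then show "\<exists>no. \<forall>n\<ge>no. norm (h n - 0) < r" by blast
  qed
  moreover have "h n > 0" for n by (simp add: h_def)
  ultimately show ?thesis using that by blast
qed

text \<open>A crude Potter bound: one iterates \<open>V t \<le> K V (2 t)\<close> about \<open>log\<^sub>2 (t / s)\<close> times, and monotonicity takes
  care of the rounding.  Any polynomial rate is good enough for the applications below.\<close>

lemma polynomial_tail_comparison:
  fixes V :: "real \<Rightarrow> real"
  assumes anti: "antimono V" and pos: "\<And>t. V t > 0"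
    and lim: "((\<lambda>t. V (t * 2) / V t) \<longlongrightarrow> c) at_top" and "c > 0"
  obtains C t0 and g :: nat where "C > 0" "t0 > 0"
    "\<And>s t. t0 \<le> s \<Longrightarrow> s \<le> t \<Longrightarrow> V s \<le> C * (t / s) ^ g * V t"
proof -
  have "\<forall>\<^sub>F t in at_top. V (t * 2) / V t > c / 2"
    using lim \<open>c > 0\<close> by (intro order_tendstoD) auto
  then obtain t1 where t1: "\<And>t. t \<ge> t1 \<Longrightarrow> V (t * 2) / V t > c / 2"
    by (auto simp: eventually_at_top_linorder)
  define t0 where "t0 = max 1 t1"
  define K where "K = max 2 (2 / c)"
  have K: "K \<ge> 2" "K > 0" by (auto simp: K_def)
  have dbl: "V t \<le> K * V (t * 2)" if "t \<ge> t0" for t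
  proof -
    have "V (t * 2) / V t > c / 2" using that t1 by (simp add: t0_def)
    then have "V t \<le> 2 / c * V (t * 2)" using pos[of t] \<open>c > 0\<close> by (simp add: field_simps)
    also have "\<dots> \<le> K * V (t * 2)" using pos[of "t*2"] by (intro mult_right_mono) (auto simp: K_def)
    finally show ?thesis .
  qed
  have iter: "V s \<le> K ^ m * V (2 ^ m * s)" if "s \<ge> t0" for s m
  proof (induction m)
    case (Suc m)
    have "1 * s \<le> 2 ^ m * s" using that by (intro mult_right_mono) (auto simp: t0_def)
    then have "V (2 ^ m * s) \<le> K * V (2 ^ m * s * 2)" using that by (intro dbl) auto
    then have "K ^ m * V (2 ^ m * s) \<le> K ^ m * (K * V (2 ^ m * s * 2))"
      using K by (intro mult_left_mono) auto
    with Suc show ?case by (simp add: mult_ac)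
  qed simp
  define g where "g = nat \<lceil>log 2 K\<rceil>"
  have "V s \<le> K * (t / s) ^ g * V t" if "t0 \<le> s" "s \<le> t" for s t
  proof -
    have s: "s > 0" using that by (simp add: t0_def)
    define m where "m = nat \<lceil>log 2 (t / s)\<rceil>"
    have ge1: "t / s \<ge> 1" using s that by simp
    have lg: "log 2 (t / s) \<ge> 0" using ge1 by simp
    have m: "log 2 (t / s) \<le> real m" "real m \<le> log 2 (t / s) + 1"
      using lg by (auto simp: m_def)
    have "t / s \<le> 2 powr real m" using m ge1 by (subst (asm) log_le_iff) auto
    then have "t \<le> 2 ^ m * s" using s by (simp add: powr_realpow field_simps)
    then have "V (2 ^ m * s) \<le> V t" using anti by (simp add: antimono_def)
    then have 1: "V s \<le> K ^ m * V t"
      using iter[OF that(1), of m] K by (meson mult_left_mono order_trans zero_le_power less_imp_le)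
    have "K ^ m = K powr real m" using K by (simp add: powr_realpow)
    also have "\<dots> \<le> K powr (log 2 (t / s) + 1)" using K m by (intro powr_mono) auto
    also have "\<dots> = K * K powr log 2 (t / s)" using K by (simp add: powr_add)
    also have "K powr log 2 (t / s) \<le> (t / s) ^ g"
    proof -
      have "K powr log 2 (t / s) = (t / s) powr log 2 K"
        using ge1 s that K by (simp add: powr_def log_def)
      also have "\<dots> \<le> (t / s) powr real g"
        using ge1 by (intro powr_mono) (auto simp: g_def intro: real_nat_ceiling_ge)
      also have "\<dots> = (t / s) ^ g" using ge1 by (simp add: powr_realpow)
      finally show ?thesis .
    qed
    finally have "K ^ m * V t \<le> K * (t / s) ^ g * V t"
      using pos[of t] K by (intro mult_right_mono) auto
    with 1 show ?thesis by simp
  qed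
  then show ?thesis using that[of K t0 g] K by (auto simp: t0_def)
qed

section \<open>Sums of independent Pareto variables clipped at 1\<close>

primrec sum_law :: "nat \<Rightarrow> real measure \<Rightarrow> real measure" where
  "sum_law 0 Q = return borel 0"
| "sum_law (Suc m) Q = convolution Q (sum_law m Q)"

lemma real_distribution_convolution:
  assumes "real_distribution Q" "real_distribution R"
  shows "real_distribution (convolution Q R)"
proof -
  interpret Q: real_distribution Q by fact
  interpret R: real_distribution R by fact
  interpret QR: pair_prob_space Q R ..
  show ?thesis
    unfolding convolution_def by (rule QR.real_distribution_distr) simp
qed

lemma char_convolution:
  assumes "real_distribution Q" "real_distribution R"
  shows "char (convolution Q R) t = char Q t * char R t"
proof -
  interpret Q: real_distribution Q by fact
  interpret R: real_distribution R by fact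
  interpret QR: pair_prob_space Q R ..
  have int: "integrable (Q \<Otimes>\<^sub>M R) (\<lambda>(x, y). iexp (t * x) * iexp (t * y))"
    by (rule QR.integrable_const_bound[of _ 1]) (auto simp: norm_mult simp del: of_real_mult)
  have "char (convolution Q R) t = (CLINT p|Q \<Otimes>\<^sub>M R. (case p of (x, y) \<Rightarrow> iexp (t * x) * iexp (t * y)))"
    unfolding char_def convolution_def
    by (subst integral_distr) (auto simp: distrib_left exp_add split_beta' intro!: Bochner_Integration.integral_cong)
  also have "\<dots> = (CLINT x|Q. (CLINT y|R. iexp (t * x) * iexp (t * y)))"
    using QR.integral_fst'[OF int] by simp
  also have "\<dots> = char Q t * char R t"
    by (simp add: char_def)
  finally show ?thesis .
qed

lemma real_distribution_sum_law:
  assumes "real_distribution Q"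
  shows "real_distribution (sum_law m Q)"
proof (induction m)
  case 0
  have "prob_space (return borel (0::real))" by (rule prob_space_return) simp
  then show ?case by (simp add: real_distribution_def real_distribution_axioms_def)
next
  case (Suc m)
  then show ?case using assms by (simp add: real_distribution_convolution)
qed

lemma char_sum_law:
  assumes "real_distribution Q"
  shows "char (sum_law m Q) t = char Q t ^ m"
proof (induction m)
  case 0
  have "char (return borel (0::real)) t = iexp (t * 0)"
    unfolding char_def by (rule integral_return) auto
  then show ?case by simp
next
  case (Suc m)
  then show ?case
    using char_convolution[OF assms real_distribution_sum_law[OF assms]] by simp
qed

text \<open>By Levy's continuity theorem, since characteristic functions turn convolution powers into powers.\<close>

lemma weak_conv_sum_law:
  assumes "\<And>n. real_distribution (Q n)" "real_distribution R" "weak_conv_m Q R"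
  shows "weak_conv_m (\<lambda>n. sum_law m (Q n)) (sum_law m R)"
proof (rule levy_continuity)
  show "(\<lambda>n. char (sum_law m (Q n)) t) \<longlonglongrightarrow> char (sum_law m R) t" for t
    unfolding char_sum_law[OF assms(1)] char_sum_law[OF assms(2)]
    by (intro tendsto_power levy_continuity1 assms)
qed (intro real_distribution_sum_law assms)+

lemma emeasure_sum_law_Suc:
  assumes "real_distribution Q" and [measurable]: "A \<in> sets borel"
  shows "emeasure (sum_law (Suc m) Q) A = (\<integral>\<^sup>+x. emeasure (sum_law m Q) {y. y + x \<in> A} \<partial>Q)"
proof -
  interpret Q: real_distribution Q by fact
  interpret S: real_distribution "sum_law m Q" by (rule real_distribution_sum_law) fact
  show ?thesis
    using Q.finite_measure_axioms S.finite_measure_axioms by (simp add: convolution_emeasure)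
qed

text \<open>The law of \<open>min T 1\<close> for a Pareto variable \<open>T\<close> with exponent \<open>\<alpha>\<close> and minimum \<open>d\<close>.\<close>

definition pareto_clipped :: "real \<Rightarrow> real \<Rightarrow> real measure" where
  "pareto_clipped \<alpha> d = distr (density lborel
     (\<lambda>t. ennreal (indicator {d<..} t * (\<alpha> * d powr \<alpha> * t powr (- \<alpha> - 1))))) borel (\<lambda>t. min t 1)"

lemma nn_integral_power_tail:
  fixes \<alpha> a :: real
  assumes "\<alpha> > 0" "a > 0"
  shows "(\<integral>\<^sup>+t. ennreal (indicator {a<..} t * (\<alpha> * t powr (- \<alpha> - 1))) \<partial>lborel) = ennreal (a powr (- \<alpha>))"
proof -
  have "(\<integral>\<^sup>+t. ennreal (indicator {a<..} t * (\<alpha> * t powr (- \<alpha> - 1))) \<partial>lborel)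
      = (\<integral>\<^sup>+t. ennreal (\<alpha> * t powr (- \<alpha> - 1)) * indicator {a..} t \<partial>lborel)"
    by (intro nn_integral_cong_AE, rule AE_mp[OF AE_lborel_singleton[of a]])
       (auto simp: indicator_def)
  also have "\<dots> = ennreal (0 - (- (a powr (- \<alpha>))))"
  proof (rule nn_integral_FTC_atLeast)
    show "((\<lambda>t. - (t powr (- \<alpha>))) has_real_derivative \<alpha> * x powr (- \<alpha> - 1)) (at x)" if "a \<le> x" for x
      using that assms by (auto intro!: derivative_eq_intros)
    show "((\<lambda>t. - (t powr (- \<alpha>))) \<longlongrightarrow> 0) at_top"
      using assms tendsto_neg_powr[of "-\<alpha>" "\<lambda>x::real. x" at_top] tendsto_minus
      by (fastforce simp: filterlim_ident)
  qed (use assms in auto)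
  finally show ?thesis by simp
qed

lemma emeasure_pareto_clipped:
  assumes "\<alpha> > 0" "d > 0" and [measurable]: "A \<in> sets borel"
  shows "emeasure (pareto_clipped \<alpha> d) A
    = (\<integral>\<^sup>+t. ennreal (d powr \<alpha>) * (ennreal (indicator {d<..} t * (\<alpha> * t powr (- \<alpha> - 1))) * indicator A (min t 1)) \<partial>lborel)"
proof -
  have "emeasure (pareto_clipped \<alpha> d) A = (\<integral>\<^sup>+x. indicator A x \<partial>pareto_clipped \<alpha> d)"
    by (simp add: pareto_clipped_def)
  also have "\<dots> = (\<integral>\<^sup>+t. ennreal (indicator {d<..} t * (\<alpha> * d powr \<alpha> * t powr (- \<alpha> - 1))) *
      indicator A (min t 1) \<partial>lborel)"
    unfolding pareto_clipped_def
    by (subst nn_integral_distr, simp, simp, subst nn_integral_density) simp_all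
  also have "\<dots> = (\<integral>\<^sup>+t. ennreal (d powr \<alpha>) *
      (ennreal (indicator {d<..} t * (\<alpha> * t powr (- \<alpha> - 1))) * indicator A (min t 1)) \<partial>lborel)"
    using assms by (intro nn_integral_cong) (auto simp: indicator_def ennreal_mult[symmetric] mult_ac)
  finally show ?thesis .
qed

lemma emeasure_pareto_clipped_greaterThan:
  assumes "\<alpha> > 0" "d > 0"
  shows "emeasure (pareto_clipped \<alpha> d) {x<..} = (if x \<ge> 1 then 0 else ennreal ((max x d / d) powr (- \<alpha>)))"
proof (cases "x \<ge> 1")
  case True
  then show ?thesis using assms
    by (subst emeasure_pareto_clipped) (auto simp: nn_integral_0_iff_AE)
next
  case False
  have "emeasure (pareto_clipped \<alpha> d) {x<..} = (\<integral>\<^sup>+t. ennreal (d powr \<alpha>) *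
      ennreal (indicator {max x d<..} t * (\<alpha> * t powr (- \<alpha> - 1))) \<partial>lborel)"
    using assms False by (subst emeasure_pareto_clipped) (auto intro!: nn_integral_cong simp: indicator_def)
  also have "\<dots> = ennreal (d powr \<alpha>) * ennreal (max x d powr (- \<alpha>))"
    using assms by (subst nn_integral_cmult) (auto simp: nn_integral_power_tail)
  also have "\<dots> = ennreal ((max x d / d) powr (- \<alpha>))"
    using assms by (auto simp: ennreal_mult[symmetric] powr_divide powr_minus field_simps)
  finally show ?thesis using False by simp
qed

lemma real_distribution_pareto_clipped:
  assumes "\<alpha> > 0" "d > 0"
  shows "real_distribution (pareto_clipped \<alpha> d)"
proof -
  have "emeasure (pareto_clipped \<alpha> d) UNIV = (\<integral>\<^sup>+t. ennreal (d powr \<alpha>) *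
      ennreal (indicator {d<..} t * (\<alpha> * t powr (- \<alpha> - 1))) \<partial>lborel)"
    using assms by (subst emeasure_pareto_clipped) auto
  also have "\<dots> = ennreal (d powr \<alpha>) * ennreal (d powr (- \<alpha>))"
    using assms by (subst nn_integral_cmult) (auto simp: nn_integral_power_tail)
  also have "\<dots> = 1"
    using assms by (auto simp: ennreal_mult[symmetric] powr_minus)
  finally have "prob_space (pareto_clipped \<alpha> d)"
    by (intro prob_spaceI) (simp add: pareto_clipped_def)
  then show ?thesis
    by (auto simp: real_distribution_def real_distribution_axioms_def pareto_clipped_def)
qed

lemma nn_integral_pareto_clipped:
  fixes f :: "real \<Rightarrow> ennreal"
  assumes "\<alpha> > 0" "0 < d" "d < 1" and [measurable]: "f \<in> borel_measurable borel"
  shows "(\<integral>\<^sup>+x. f x \<partial>pareto_clipped \<alpha> d) = ennreal (d powr \<alpha>) *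
    (f 1 + (\<integral>\<^sup>+t. f t * ennreal (indicator {d<..<1} t * (\<alpha> * t powr (- \<alpha> - 1))) \<partial>lborel))"
proof -
  let ?k = "\<lambda>t. \<alpha> * t powr (- \<alpha> - 1)"
  have "(\<integral>\<^sup>+x. f x \<partial>pareto_clipped \<alpha> d)
      = (\<integral>\<^sup>+t. ennreal (indicator {d<..} t * (\<alpha> * d powr \<alpha> * t powr (- \<alpha> - 1))) * f (min t 1) \<partial>lborel)"
    unfolding pareto_clipped_def by (simp add: nn_integral_distr nn_integral_density)
  also have "\<dots> = (\<integral>\<^sup>+t. ennreal (d powr \<alpha>) * (f 1 * ennreal (indicator {1<..} t * ?k t)
        + f t * ennreal (indicator {d<..<1} t * ?k t)) \<partial>lborel)"
    by (intro nn_integral_cong_AE, rule AE_mp[OF AE_lborel_singleton[of 1]])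
       (use assms in \<open>auto simp: indicator_def ennreal_mult mult_ac min_def\<close>)
  also have "\<dots> = ennreal (d powr \<alpha>) * (f 1 * ennreal (1 powr (- \<alpha>))
       + (\<integral>\<^sup>+t. f t * ennreal (indicator {d<..<1} t * ?k t) \<partial>lborel))"
    using assms(1) nn_integral_power_tail[of \<alpha> 1]
    by (simp add: nn_integral_cmult nn_integral_add)
  finally show ?thesis by simp
qed

text \<open>Either all summands are in the atom at \<open>1\<close>, and then the sum is an integer, or one of them has a density.  In the
  induction the summand that is split off avoids the countably many translates of the integers almost surely.\<close>

lemma pareto_sum_law_no_atoms:
  assumes "\<alpha> > 0" "0 < d" "d < 1" "z \<notin> \<int>"
  shows "emeasure (sum_law m (pareto_clipped \<alpha> d)) {z} = 0"
  using assms(4)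
proof (induction m arbitrary: z)
  case 0
  then show ?case by (auto simp: indicator_def)
next
  case (Suc m)
  note Q = real_distribution_pareto_clipped[OF assms(1,2)]
  interpret S: real_distribution "sum_law m (pareto_clipped \<alpha> d)" by (rule real_distribution_sum_law[OF Q])
  let ?f = "\<lambda>x. emeasure (sum_law m (pareto_clipped \<alpha> d)) {z - x}"
  have eq: "{y. y + x \<in> {z}} = {z - x}" for x by auto
  have meas[measurable]: "?f \<in> borel_measurable borel"
  proof -
    have "?f = (\<lambda>x. \<integral>\<^sup>+y. indicator {z} (x + y) \<partial>sum_law m (pareto_clipped \<alpha> d))"
    proof
      fix x
      have "?f x = (\<integral>\<^sup>+y. indicator {z - x} y \<partial>sum_law m (pareto_clipped \<alpha> d))" by simp
      also have "\<dots> = (\<integral>\<^sup>+y. indicator {z} (x + y) \<partial>sum_law m (pareto_clipped \<alpha> d))"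
        by (intro nn_integral_cong) (auto simp: indicator_def)
      finally show "?f x = \<dots>" .
    qed
    then show ?thesis by simp
  qed
  have "emeasure (sum_law (Suc m) (pareto_clipped \<alpha> d)) {z} = (\<integral>\<^sup>+x. ?f x \<partial>pareto_clipped \<alpha> d)"
    unfolding eq[symmetric] by (rule emeasure_sum_law_Suc[OF Q]) simp
  also have "\<dots> = ennreal (d powr \<alpha>) * (?f 1 +
     (\<integral>\<^sup>+t. ?f t * ennreal (indicator {d<..<1} t * (\<alpha> * t powr (- \<alpha> - 1))) \<partial>lborel))"
    by (rule nn_integral_pareto_clipped) (use assms in auto)
  also have "?f 1 = 0" using Suc.prems by (intro Suc.IH) (metis Ints_1 Ints_add diff_add_cancel)
  also have "(\<integral>\<^sup>+t. ?f t * ennreal (indicator {d<..<1} t * (\<alpha> * t powr (- \<alpha> - 1))) \<partial>lborel) = 0"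
  proof -
    have "countable ((\<lambda>i. z - i) ` \<int>)" by (intro countable_image) (simp add: Ints_def)
    then have "AE t in lborel. t \<notin> (\<lambda>i. z - i) ` \<int>"
      by (rule AE_not_in[OF countable_imp_null_set_lborel])
    then have "AE t in lborel. ?f t * ennreal (indicator {d<..<1} t * (\<alpha> * t powr (- \<alpha> - 1))) = 0"
    proof eventually_elim
      case (elim t)
      have "z - t \<notin> \<int>"
      proof
        assume "z - t \<in> \<int>"
        then have "t \<in> (\<lambda>i. z - i) ` \<int>" by (intro image_eqI[of _ _ "z - t"]) auto
        then show False using elim by simp
      qed
      then show ?case by (simp add: Suc.IH)
    qed
    then show ?thesis using nn_integral_cong_AE by fastforce
  qed
  finally show ?case by simp
qed

text \<open>For \<open>m \<ge> 1\<close> this is \<open>W\<^sub>m(z)\<close> with all coordinates restricted to values above \<open>d\<close>, computed one coordinate at a time.  Values in \<open>ennreal\<close> make the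
  recursion meaningful for every \<open>z\<close>.\<close>

primrec simplex_weight :: "real \<Rightarrow> real \<Rightarrow> nat \<Rightarrow> real \<Rightarrow> ennreal" where
  "simplex_weight \<alpha> d 0 z = indicator {..<0} z"
| "simplex_weight \<alpha> d (Suc m) z =
     (\<integral>\<^sup>+t. simplex_weight \<alpha> d m (z - t) * ennreal (indicator {d<..<1} t * (\<alpha> * t powr (- \<alpha> - 1))) \<partial>lborel)"

lemma measurable_simplex_weight [measurable]: "simplex_weight \<alpha> d m \<in> borel_measurable borel"
  by (induction m) simp_all

lemma simplex_weight_finite:
  assumes "\<alpha> > 0" "0 < d"
  shows "simplex_weight \<alpha> d m z < \<infinity>"
proof -
  have "simplex_weight \<alpha> d m z \<le> ennreal (d powr (- \<alpha>)) ^ m"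
  proof (induction m arbitrary: z)
    case 0
    then show ?case by (simp add: indicator_def)
  next
    case (Suc m)
    have "simplex_weight \<alpha> d (Suc m) z \<le> (\<integral>\<^sup>+t. ennreal (d powr (- \<alpha>)) ^ m *
        ennreal (indicator {d<..} t * (\<alpha> * t powr (- \<alpha> - 1))) \<partial>lborel)"
      unfolding simplex_weight.simps using assms
      by (intro nn_integral_mono mult_mono Suc ennreal_leI) (auto simp: indicator_def)
    also have "\<dots> = ennreal (d powr (- \<alpha>)) ^ Suc m"
      using assms by (subst nn_integral_cmult) (auto simp: nn_integral_power_tail mult.commute)
    finally show ?case .
  qed
  also have "\<dots> < \<infinity>" by (simp add: ennreal_power)
  finally show ?thesis .
qed

text \<open>Pascal's rule for a new summand, which is either in the atom or in the continuous part.\<close>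

lemma sum_choose_Suc:
  fixes f :: "nat \<Rightarrow> 'b::comm_semiring_1"
  shows "(\<Sum>j\<le>Suc m. of_nat (Suc m choose j) * f j)
    = (\<Sum>j\<le>m. of_nat (m choose j) * f (Suc j)) + (\<Sum>j\<le>m. of_nat (m choose j) * f j)"
proof -
  have "(\<Sum>j\<le>m. of_nat (m choose j) * f j) = (\<Sum>j\<le>Suc m. of_nat (m choose j) * f j)"
    by (simp add: binomial_eq_0)
  also have "\<dots> = f 0 + (\<Sum>j\<le>m. of_nat (m choose Suc j) * f (Suc j))"
    unfolding sum.atMost_Suc_shift by simp
  finally show ?thesis
    unfolding sum.atMost_Suc_shift[of _ m] by (simp add: sum.distrib algebra_simps)
qed

text \<open>In the \<open>j\<close>-th term, \<open>j\<close> of the \<open>m\<close> summands are in the atom at \<open>1\<close> and lower the level by \<open>j\<close>.\<close>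

lemma emeasure_pareto_sum_tail:
  assumes "\<alpha> > 0" "0 < d" "d < 1"
  shows "emeasure (sum_law m (pareto_clipped \<alpha> d)) {z<..} =
    ennreal (d powr \<alpha>) ^ m * (\<Sum>j\<le>m. of_nat (m choose j) * simplex_weight \<alpha> d (m - j) (z - real j))"
proof (induction m arbitrary: z)
  case 0
  show ?case by (auto simp: indicator_def)
next
  case (Suc m)
  note Q = real_distribution_pareto_clipped[OF assms(1,2)]
  let ?B = "simplex_weight \<alpha> d"
  let ?k = "\<lambda>t. ennreal (indicator {d<..<1} t * (\<alpha> * t powr (- \<alpha> - 1)))"
  let ?g = "\<lambda>z. \<Sum>j\<le>m. of_nat (m choose j) * ?B (m - j) (z - real j)"
  have eq: "{y. y + x \<in> {z<..}} = {z - x<..}" for x by auto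
  have "emeasure (sum_law (Suc m) (pareto_clipped \<alpha> d)) {z<..} =
      (\<integral>\<^sup>+x. emeasure (sum_law m (pareto_clipped \<alpha> d)) {z - x<..} \<partial>pareto_clipped \<alpha> d)"
    unfolding eq[symmetric] by (rule emeasure_sum_law_Suc[OF Q]) simp
  also have "\<dots> = (\<integral>\<^sup>+x. ennreal (d powr \<alpha>) ^ m * ?g (z - x) \<partial>pareto_clipped \<alpha> d)"
    by (simp add: Suc.IH)
  also have "\<dots> = ennreal (d powr \<alpha>) * (ennreal (d powr \<alpha>) ^ m * ?g (z - 1) +
      (\<integral>\<^sup>+t. ennreal (d powr \<alpha>) ^ m * ?g (z - t) * ?k t \<partial>lborel))"
    by (rule nn_integral_pareto_clipped[OF assms]) simp
  also have "(\<integral>\<^sup>+t. ennreal (d powr \<alpha>) ^ m * ?g (z - t) * ?k t \<partial>lborel)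
      = ennreal (d powr \<alpha>) ^ m * (\<integral>\<^sup>+t. ?g (z - t) * ?k t \<partial>lborel)"
    by (simp add: nn_integral_cmult mult.assoc)
  also have "(\<integral>\<^sup>+t. ?g (z - t) * ?k t \<partial>lborel)
      = (\<integral>\<^sup>+t. (\<Sum>j\<le>m. of_nat (m choose j) * (?B (m - j) (z - real j - t) * ?k t)) \<partial>lborel)"
  proof -
    have "z - t - real j = z - real j - t" for t and j :: nat by simp
    then show ?thesis by (simp only: sum_distrib_right mult.assoc)
  qed
  also have "\<dots> = (\<Sum>j\<le>m. of_nat (m choose j) * ?B (Suc m - j) (z - real j))"
    by (simp add: nn_integral_sum nn_integral_cmult Suc_diff_le)
  finally show ?case
    unfolding sum_choose_Suc by (simp add: algebra_simps)
qed

text \<open>The other \<open>m - 1\<close> coordinates are below \<open>1\<close>.  This is why integration over the coordinates in \<open>(d, 1)\<close>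
  suffices as soon as \<open>z > m - 1 + d\<close>.\<close>

lemma D_simplex_coordinate_bound:
  assumes "x \<in> D_simplex m z" "j \<in> {1..m}"
  shows "x j > z - (real m - 1)"
proof -
  have "z < (\<Sum>i=1..m. x i)" using assms by (simp add: D_simplex_def)
  also have "\<dots> = x j + (\<Sum>i\<in>{1..m} - {j}. x i)" using assms by (intro sum.remove) auto
  also have "(\<Sum>i\<in>{1..m} - {j}. x i) \<le> (\<Sum>i\<in>{1..m} - {j}. 1)"
    using assms by (intro sum_mono) (auto simp: D_simplex_def intro: less_imp_le)
  also have "(\<Sum>i\<in>{1..m} - {j}. 1) = real m - 1"
    using assms by (simp add: of_nat_diff)
  finally show ?thesis by simp
qed

lemma sets_D_simplex [measurable]: "D_simplex m z \<in> sets (lborel_pow m)"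
  unfolding D_simplex_def by measurable

text \<open>Integrating out the last coordinate \<open>y\<close> reduces \<open>D\<^sub>m\<^sub>+\<^sub>1(z)\<close> to \<open>D\<^sub>m(z - y)\<close>; values \<open>y \<le> d\<close> do not occur, and all
  coordinates are positive, so the power of the product factorizes.\<close>

lemma nn_integral_D_simplex:
  assumes "\<alpha> > 0" "0 < d" "z > real m - 1 + d"
  shows "(\<integral>\<^sup>+t. ennreal (indicator (D_simplex m z) t * (\<alpha> ^ m * (\<Prod>j=1..m. t j) powr (- \<alpha> - 1))) \<partial>lborel_pow m)
    = simplex_weight \<alpha> d m z"
  using assms(3)
proof (induction m arbitrary: z)
  case 0
  interpret product_sigma_finite "\<lambda>_::nat. lborel :: real measure" ..
  show ?case by (auto simp: D_simplex_def nn_integral_empty indicator_def space_PiM)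
next
  case (Suc m)
  interpret product_sigma_finite "\<lambda>_::nat. lborel :: real measure" ..
  let ?f = "\<lambda>m z t. ennreal (indicator (D_simplex m z) t * (\<alpha> ^ m * (\<Prod>j=1..m. t j) powr (- \<alpha> - 1)))"
  let ?k = "\<lambda>t. ennreal (indicator {d<..<1} t * (\<alpha> * t powr (- \<alpha> - 1)))"
  have ins: "{1..Suc m} = insert (Suc m) {1..m}" by auto
  have meas: "?f m z \<in> borel_measurable (lborel_pow m)" for m z by measurable
  have split: "?f (Suc m) z (x(Suc m := y)) = ?k y * ?f m (z - y) x"
    if x: "x \<in> space (lborel_pow m)" for x y
  proof -
    have sp: "x(Suc m := y) \<in> space (lborel_pow (Suc m))"
      using x by (auto simp: space_PiM PiE_def extensional_def)
    have D: "x(Suc m := y) \<in> D_simplex (Suc m) z \<longleftrightarrow> y < 1 \<and> x \<in> D_simplex m (z - y)"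
      using x sp by (auto simp: D_simplex_def ins algebra_simps)
    show ?thesis
    proof (cases "x(Suc m := y) \<in> D_simplex (Suc m) z")
      case True
      have y: "y > d" using D_simplex_coordinate_bound[OF True, of "Suc m"] Suc.prems by simp
      have "y < 1" "x \<in> D_simplex m (z - y)" using D True by auto
      have "x j > 0" if "j \<in> {1..m}" for j
        using D_simplex_coordinate_bound[OF True, of j] Suc.prems that assms by auto
      then have "(\<Prod>j=1..m. x j) \<ge> 0" by (intro prod_nonneg) (auto intro: less_imp_le)
      then show ?thesis
        using True \<open>y < 1\<close> \<open>x \<in> D_simplex m (z - y)\<close> y assms
        by (simp add: ins powr_mult ennreal_mult[symmetric] mult_ac)
    next
      case False
      then show ?thesis using D by (auto simp: indicator_def)
    qed
  qed
  have "(\<integral>\<^sup>+t. ?f (Suc m) z t \<partial>lborel_pow (Suc m)) =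
      (\<integral>\<^sup>+y. (\<integral>\<^sup>+x. ?f (Suc m) z (x(Suc m := y)) \<partial>lborel_pow m) \<partial>lborel)"
    using meas[of "Suc m" z] unfolding ins by (intro product_nn_integral_insert_rev) auto
  also have "\<dots> = (\<integral>\<^sup>+y. (\<integral>\<^sup>+x. ?k y * ?f m (z - y) x \<partial>lborel_pow m) \<partial>lborel)"
    by (intro nn_integral_cong) (rule split)
  also have "\<dots> = (\<integral>\<^sup>+y. ?k y * (\<integral>\<^sup>+x. ?f m (z - y) x \<partial>lborel_pow m) \<partial>lborel)"
    by (intro nn_integral_cong nn_integral_cmult meas)
  also have "\<dots> = (\<integral>\<^sup>+y. simplex_weight \<alpha> d m (z - y) * ?k y \<partial>lborel)"
  proof (intro nn_integral_cong)
    fix y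
    show "?k y * (\<integral>\<^sup>+x. ?f m (z - y) x \<partial>lborel_pow m) = simplex_weight \<alpha> d m (z - y) * ?k y"
    proof (cases "d < y \<and> y < 1")
      case True
      then show ?thesis using Suc.prems by (subst Suc.IH) (auto simp: mult.commute)
    qed auto
  qed
  finally show ?case by simp
qed

lemma W_fun_eq_simplex_weight:
  assumes "\<alpha> > 0" "0 < d" "real m - 1 + d < z" "z < real m"
  shows "W_fun \<alpha> m z = enn2real (simplex_weight \<alpha> d m z)"
proof (cases "m = 0")
  case True
  then show ?thesis using assms by (simp add: W_fun_def)
next
  case False
  have "W_fun \<alpha> m z = (LINT t|lborel_pow m. indicator (D_simplex m z) t * (\<alpha> ^ m * (\<Prod>j=1..m. t j) powr (- \<alpha> - 1)))"
    using False by (simp add: W_fun_def set_lebesgue_integral_def mult.left_commute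
        flip: integral_mult_right_zero)
  also have "\<dots> = enn2real (\<integral>\<^sup>+t. ennreal (indicator (D_simplex m z) t * (\<alpha> ^ m * (\<Prod>j=1..m. t j) powr (- \<alpha> - 1))) \<partial>lborel_pow m)"
  proof (rule integral_eq_nn_integral)
    show "(\<lambda>t. indicator (D_simplex m z) t * (\<alpha> ^ m * (\<Prod>j=1..m. t j) powr (- \<alpha> - 1)))
        \<in> borel_measurable (lborel_pow m)" by measurable
  qed (use assms in \<open>auto simp: indicator_def\<close>)
  finally show ?thesis
    by (simp only: nn_integral_D_simplex[OF assms(1-3)])
qed

lemma measure_pareto_sum_tail:
  assumes "\<alpha> > 0" "0 < d" "d < 1" "real k - 1 + d < z" "z < real k"
  shows "measure (sum_law k (pareto_clipped \<alpha> d)) {z<..} =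
    (d powr \<alpha>) ^ k * (\<Sum>j=0..k. real (k choose j) * W_fun \<alpha> (k - j) (z - real j))"
proof -
  let ?B = "simplex_weight \<alpha> d"
  have "enn2real (\<Sum>j\<le>k. of_nat (k choose j) * ?B (k - j) (z - real j))
      = (\<Sum>j\<le>k. enn2real (of_nat (k choose j) * ?B (k - j) (z - real j)))"
    using simplex_weight_finite[OF assms(1,2)]
    by (subst enn2real_sum) (auto simp: ennreal_mult_less_top of_nat_less_top)
  also have "\<dots> = (\<Sum>j=0..k. real (k choose j) * W_fun \<alpha> (k - j) (z - real j))"
    using assms by (intro sum.cong) (auto simp: enn2real_mult W_fun_eq_simplex_weight[of \<alpha> d] of_nat_diff)
  finally show ?thesis
    unfolding measure_def emeasure_pareto_sum_tail[OF assms(1-3)]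
    by (simp add: enn2real_mult ennreal_power)
qed

section \<open>Independent summands with a regularly varying tail\<close>

lemma integral_uniform_measure:
  fixes f :: "'a \<Rightarrow> 'b::{banach, second_countable_topology}"
  assumes A: "emeasure M A \<noteq> 0" "emeasure M A \<noteq> \<infinity>" and [measurable]: "f \<in> borel_measurable M"
  shows "(LINT x|uniform_measure M A. f x) = (1 / measure M A) *\<^sub>R (LINT x|M. indicator A x *\<^sub>R f x)"
proof -
  have [measurable]: "A \<in> sets M" using emeasure_neq_0_sets[OF A(1)] .
  have pos: "measure M A > 0" using A by (simp add: measure_def enn2real_positive_iff zero_less_iff_neq_zero top.not_eq_extremum)
  have "uniform_measure M A = density M (\<lambda>x. ennreal (indicator A x / measure M A))"
    unfolding uniform_measure_def using A pos
    by (intro density_cong) (auto simp: emeasure_eq_ennreal_measure divide_ennreal indicator_def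
        simp flip: ennreal_1)
  then have "(LINT x|uniform_measure M A. f x) = (LINT x|M. (indicator A x / measure M A) *\<^sub>R f x)"
    by (simp add: integral_density)
  also have "\<dots> = (LINT x|M. (1 / measure M A) *\<^sub>R (indicator A x *\<^sub>R f x))"
    by simp
  finally show ?thesis by (simp only: integral_scaleR_right)
qed

lemma (in real_distribution) cdf_eq_tail: "cdf M x = 1 - measure M {x<..}"
proof -
  have "UNIV - {..x} = {x<..}" by auto
  then show ?thesis using prob_compl[of "{..x}"] by (simp add: cdf_def2)
qed

locale heavy_tailed_iid = prob_space P for P :: "'a measure" +
  fixes \<xi> :: "nat \<Rightarrow> 'a \<Rightarrow> real" and L :: "real \<Rightarrow> real" and \<alpha> :: real
  assumes indep: "indep_vars (\<lambda>_. borel) \<xi> UNIV"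
    and ident: "\<And>j. distr P borel (\<xi> j) = distr P borel (\<xi> 0)"
    and integrable_gen: "integrable P (\<xi> 0)" and mean_gen: "(LINT \<omega>|P. \<xi> 0 \<omega>) = 0"
    and integrable_sq_gen: "integrable P (\<lambda>\<omega>. (\<xi> 0 \<omega>)\<^sup>2)" and var_gen: "(LINT \<omega>|P. (\<xi> 0 \<omega>)\<^sup>2) = 1"
    and alpha: "\<alpha> > 2" and slow: "slowly_varying L"
    and tail: "\<And>t. t > 0 \<Longrightarrow> right_tail P (\<xi> 0) t = t powr (- \<alpha>) * L t"
begin

abbreviation V :: "real \<Rightarrow> real" where "V \<equiv> right_tail P (\<xi> 0)"

lemma rv [measurable]: "\<xi> j \<in> borel_measurable P"
  using indep by (simp add: indep_vars_def2)

lemma integral_ident: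
  fixes f :: "real \<Rightarrow> 'b::{banach, second_countable_topology}"
  assumes [measurable]: "f \<in> borel_measurable borel"
  shows "(LINT \<omega>|P. f (\<xi> j \<omega>)) = (LINT \<omega>|P. f (\<xi> 0 \<omega>))"
  using arg_cong[OF ident, of "\<lambda>D. integral\<^sup>L D f" j] by (simp add: integral_distr)

lemma integrable_ident:
  fixes f :: "real \<Rightarrow> 'b::{banach, second_countable_topology}"
  assumes [measurable]: "f \<in> borel_measurable borel"
  shows "integrable P (\<lambda>\<omega>. f (\<xi> j \<omega>)) \<longleftrightarrow> integrable P (\<lambda>\<omega>. f (\<xi> 0 \<omega>))"
  using arg_cong[OF ident, of "\<lambda>D. integrable D f" j] by (simp add: integrable_distr_eq)

lemma prob_gt: "prob {\<omega> \<in> space P. \<xi> j \<omega> > t} = V t"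
proof -
  have "measure (distr P borel (\<xi> j)) {t<..} = measure (distr P borel (\<xi> 0)) {t<..}"
    by (simp only: ident[of j])
  then show ?thesis
    by (simp add: measure_distr right_tail_def vimage_def Int_def conj_commute)
qed

lemma V_antimono: "antimono V"
  unfolding antimono_def right_tail_def by (auto intro!: finite_measure_mono)

lemma V_nonneg: "V t \<ge> 0"
  by (simp add: right_tail_def)

lemma V_pos: "V t > 0"
proof -
  have "((\<lambda>t. L (t * 1) / L t) \<longlongrightarrow> 1) at_top"
    using slow unfolding slowly_varying_def by (rule allE[of _ 1]) auto
  then have "\<forall>\<^sub>F u in at_top. L (u * 1) / L u > 0" by (rule order_tendstoD) simp
  then have "\<forall>\<^sub>F u in at_top. V u \<noteq> 0 \<and> t \<le> u"
    using eventually_gt_at_top[of 0] eventually_ge_at_top[of t]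
    by eventually_elim (auto simp: tail)
  then obtain u where "V u \<noteq> 0" "t \<le> u"
    using eventually_happens'[OF trivial_limit_at_top_linorder] by blast
  then show ?thesis
    using V_antimono V_nonneg[of u] unfolding antimono_def by (metis less_eq_real_def order.trans order_antisym_conv)
qed

lemma V_ratio:
  assumes "y > 0"
  shows "((\<lambda>t. V (t * y) / V t) \<longlongrightarrow> y powr (- \<alpha>)) at_top"
proof -
  have lim: "((\<lambda>t. y powr (- \<alpha>) * (L (t * y) / L t)) \<longlongrightarrow> y powr (- \<alpha>) * 1) at_top"
    using slow assms unfolding slowly_varying_def by (intro tendsto_mult tendsto_const) auto
  have "\<forall>\<^sub>F t in at_top. y powr (- \<alpha>) * (L (t * y) / L t) = V (t * y) / V t"
    using eventually_gt_at_top[of 0]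
    by eventually_elim (use assms in \<open>auto simp: tail powr_mult\<close>)
  from Lim_transform_eventually[OF lim this] show ?thesis by simp
qed

lemma V_Markov:
  assumes "t > 0"
  shows "V t \<le> 1 / t\<^sup>2"
proof -
  have "V t \<le> prob {\<omega> \<in> space P. (\<xi> 0 \<omega>)\<^sup>2 \<ge> t\<^sup>2}"
    unfolding right_tail_def using assms by (intro finite_measure_mono) (auto intro: power_mono)
  also have "\<dots> \<le> (LINT \<omega>|P. (\<xi> 0 \<omega>)\<^sup>2) / t\<^sup>2"
    using integrable_sq_gen assms by (intro integral_Markov_inequality_measure[where A="{}"]) auto
  finally show ?thesis by (simp add: var_gen)
qed

lemma sum_moments:
  assumes "finite J"
  shows "integrable P (\<lambda>\<omega>. \<Sum>j\<in>J. \<xi> j \<omega>)" "(LINT \<omega>|P. (\<Sum>j\<in>J. \<xi> j \<omega>)) = 0"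
    and "integrable P (\<lambda>\<omega>. (\<Sum>j\<in>J. \<xi> j \<omega>)\<^sup>2)" "(LINT \<omega>|P. (\<Sum>j\<in>J. \<xi> j \<omega>)\<^sup>2) = real (card J)"
proof -
  have i1: "integrable P (\<xi> j)" and m: "(LINT \<omega>|P. \<xi> j \<omega>) = 0" for j
    using integrable_ident[of "\<lambda>x. x" j] integral_ident[of "\<lambda>x. x" j] integrable_gen mean_gen by auto
  have i2: "integrable P (\<lambda>\<omega>. (\<xi> j \<omega>)\<^sup>2)" and v: "(LINT \<omega>|P. (\<xi> j \<omega>)\<^sup>2) = 1" for j
    using integrable_ident[of "\<lambda>x. x\<^sup>2" j] integral_ident[of "\<lambda>x. x\<^sup>2" j] integrable_sq_gen var_gen by auto
  show *: "integrable P (\<lambda>\<omega>. \<Sum>j\<in>J. \<xi> j \<omega>)" "(LINT \<omega>|P. (\<Sum>j\<in>J. \<xi> j \<omega>)) = 0" for J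
    using i1 m by (auto simp: integral_sum)
  have "integrable P (\<lambda>\<omega>. (\<Sum>j\<in>J. \<xi> j \<omega>)\<^sup>2) \<and> (LINT \<omega>|P. (\<Sum>j\<in>J. \<xi> j \<omega>)\<^sup>2) = real (card J)"
    using assms
  proof (induction J)
    case (insert i J)
    let ?S = "\<lambda>\<omega>. \<Sum>j\<in>J. \<xi> j \<omega>"
    have ind: "indep_var borel (\<xi> i) borel ?S"
      using insert indep_vars_subset[OF indep] by (intro indep_vars_sum) auto
    have c: "integrable P (\<lambda>\<omega>. \<xi> i \<omega> * ?S \<omega>)" "(LINT \<omega>|P. \<xi> i \<omega> * ?S \<omega>) = 0"
      using indep_var_integrable[OF ind i1 *(1)] indep_var_lebesgue_integral[OF ind i1 *(1)] m by auto
    have eq: "(\<Sum>j\<in>insert i J. \<xi> j \<omega>)\<^sup>2 = (\<xi> i \<omega>)\<^sup>2 + (2 * (\<xi> i \<omega> * ?S \<omega>) + (?S \<omega>)\<^sup>2)" for \<omega>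
      using insert by (simp add: power2_sum)
    show ?case
      unfolding eq using insert c i2[of i] v[of i] by simp
  qed simp
  then show "integrable P (\<lambda>\<omega>. (\<Sum>j\<in>J. \<xi> j \<omega>)\<^sup>2)" "(LINT \<omega>|P. (\<Sum>j\<in>J. \<xi> j \<omega>)\<^sup>2) = real (card J)"
    by auto
qed

text \<open>The summands are centred, pairwise uncorrelated and of variance \<open>1\<close>.\<close>

lemma sum_Chebyshev:
  assumes "finite J" "b > 0"
  shows "prob {\<omega> \<in> space P. \<bar>\<Sum>j\<in>J. \<xi> j \<omega>\<bar> \<ge> b} \<le> real (card J) / b\<^sup>2"
proof -
  have "prob {\<omega> \<in> space P. \<bar>\<Sum>j\<in>J. \<xi> j \<omega>\<bar> \<ge> b} \<le> prob {\<omega> \<in> space P. (\<Sum>j\<in>J. \<xi> j \<omega>)\<^sup>2 \<ge> b\<^sup>2}"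
    using assms by (intro finite_measure_mono) (auto simp: abs_le_square_iff[symmetric])
  also have "\<dots> \<le> (LINT \<omega>|P. (\<Sum>j\<in>J. \<xi> j \<omega>)\<^sup>2) / b\<^sup>2"
    using sum_moments(3)[OF assms(1)] assms by (intro integral_Markov_inequality_measure[where A="{}"]) auto
  finally show ?thesis by (simp add: sum_moments(4)[OF assms(1)])
qed

text \<open>The exponential is at most \<open>1 + r \<xi> + r\<^sup>2 \<xi>\<^sup>2\<close> as long as \<open>r \<xi> \<le> 1\<close>; beyond, it is at most \<open>exp (r c)\<close>, which
  is weighted by \<open>V (1 / r)\<close>.  The quadratic polynomial is nonnegative there, so it may be added, and then
  its full mean \<open>1 + r\<^sup>2\<close> appears.\<close>

lemma truncated_mgf:
  assumes "r > 0" "c > 0"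
  shows "(LINT \<omega>|P. exp (r * (if \<xi> 0 \<omega> \<le> c then \<xi> 0 \<omega> else 0))) \<le> 1 + (r\<^sup>2 + exp (r * c) * V (1 / r))"
proof -
  let ?u = "\<lambda>x::real. if x \<le> c then x else 0"
  have pt: "exp (r * ?u x) \<le> 1 + (r * x + (r\<^sup>2 * x\<^sup>2 + exp (r * c) * indicator {1 / r<..} x))" for x
  proof (cases "x \<le> 1 / r")
    case True
    then have x: "r * x \<le> 1" using assms by (simp add: field_simps)
    have "exp (r * ?u x) \<le> 1 + r * x + (r * x)\<^sup>2"
    proof (cases "x \<le> c")
      case True
      then show ?thesis using exp_le_quadratic[OF x] by simp
    next
      case False
      then have "r * x > 0" using assms by simp
      then show ?thesis using False by simp
    qed
    then show ?thesis using True by (simp add: power_mult_distrib)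
  next
    case False
    then have "x > 0" using assms by (smt (verit) divide_pos_pos)
    have "r * ?u x \<le> r * c" using assms by auto
    then have "exp (r * ?u x) \<le> exp (r * c)" by simp
    moreover have "0 \<le> 1 + r * x + r\<^sup>2 * x\<^sup>2" using \<open>x > 0\<close> assms by simp
    moreover have i: "indicator {1 / r<..} x = (1::real)" using False by simp
    ultimately show ?thesis unfolding i mult_1_right by linarith
  qed
  have intI: "integrable P (\<lambda>\<omega>. indicator {1 / r<..} (\<xi> 0 \<omega>) :: real)"
    by (rule integrable_const_bound[of _ 1]) auto
  have "(\<lambda>\<omega>. indicator {1 / r<..} (\<xi> 0 \<omega>) :: real) = indicator ((\<xi> 0) -` {1/r<..})"
    by (auto simp: indicator_def)
  then have "(LINT \<omega>|P. indicator {1 / r<..} (\<xi> 0 \<omega>) :: real) = prob ((\<xi> 0) -` {1/r<..} \<inter> space P)"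
    by (simp only: Bochner_Integration.integral_indicator)
  also have "(\<xi> 0) -` {1/r<..} \<inter> space P = {\<omega> \<in> space P. \<xi> 0 \<omega> > 1 / r}" by auto
  finally have I: "(LINT \<omega>|P. indicator {1 / r<..} (\<xi> 0 \<omega>) :: real) = V (1 / r)"
    by (simp add: right_tail_def)
  have "(LINT \<omega>|P. exp (r * ?u (\<xi> 0 \<omega>))) \<le>
     (LINT \<omega>|P. 1 + (r * \<xi> 0 \<omega> + (r\<^sup>2 * (\<xi> 0 \<omega>)\<^sup>2 + exp (r * c) * indicator {1 / r<..} (\<xi> 0 \<omega>))))"
  proof (rule integral_mono_AE)
    show "integrable P (\<lambda>\<omega>. exp (r * ?u (\<xi> 0 \<omega>)))"
      by (rule integrable_const_bound[of _ "exp (r * c)"]) (use assms in auto)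
    show "integrable P (\<lambda>\<omega>. 1 + (r * \<xi> 0 \<omega> + (r\<^sup>2 * (\<xi> 0 \<omega>)\<^sup>2 + exp (r * c) * indicator {1 / r<..} (\<xi> 0 \<omega>))))"
      using integrable_gen integrable_sq_gen intI by simp
  qed (use pt in auto)
  also have "\<dots> = 1 + (r\<^sup>2 + exp (r * c) * V (1 / r))"
    using integrable_gen integrable_sq_gen intI by (simp add: prob_space mean_gen var_gen I)
  finally show ?thesis .
qed

lemma truncated_sum_Chernoff:
  assumes "r > 0" "c > 0"
  shows "prob {\<omega> \<in> space P. (\<Sum>j=1..n. if \<xi> j \<omega> \<le> c then \<xi> j \<omega> else 0) > b}
     \<le> exp (- r * b + real n * (r\<^sup>2 + exp (r * c) * V (1 / r)))"
proof -
  let ?u = "\<lambda>x::real. if x \<le> c then x else 0"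
  let ?A = "{\<omega> \<in> space P. (\<Sum>j=1..n. ?u (\<xi> j \<omega>)) > b}"
  have A [measurable]: "?A \<in> events" by measurable
  have bd: "\<bar>exp (r * ?u x)\<bar> \<le> exp (r * c)" for x using assms by auto
  have int: "integrable P (\<lambda>\<omega>. exp (r * ?u (\<xi> j \<omega>)))" for j
    by (rule integrable_const_bound[of _ "exp (r * c)"]) (use bd in auto)
  have ind: "indep_vars (\<lambda>_. borel) (\<lambda>j \<omega>. exp (r * ?u (\<xi> j \<omega>))) {1..n}"
    by (rule indep_vars_compose2[OF indep_vars_subset[OF indep]]) auto
  note pi = indep_vars_integrable[OF _ ind int] and pe = indep_vars_lebesgue_integral[OF _ ind int]
  have "prob ?A = (LINT \<omega>|P. indicator ?A \<omega>)" by simp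
  also have "\<dots> \<le> (LINT \<omega>|P. exp (- r * b) * (\<Prod>j=1..n. exp (r * ?u (\<xi> j \<omega>))))"
  proof (rule integral_mono_AE)
    show "integrable P (\<lambda>\<omega>. exp (- r * b) * (\<Prod>j=1..n. exp (r * ?u (\<xi> j \<omega>))))"
      using pi by simp
    show "AE \<omega> in P. indicator ?A \<omega> \<le> exp (- r * b) * (\<Prod>j=1..n. exp (r * ?u (\<xi> j \<omega>)))"
    proof (rule AE_I2)
      fix \<omega>
      let ?S = "\<Sum>j=1..n. ?u (\<xi> j \<omega>)"
      have eq: "exp (- r * b) * (\<Prod>j=1..n. exp (r * ?u (\<xi> j \<omega>))) = exp (r * (?S - b))"
        by (simp add: exp_sum[symmetric] sum_distrib_left[symmetric] exp_add[symmetric] algebra_simps)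
      have "indicator ?A \<omega> \<le> exp (r * (?S - b))"
        using assms by (auto simp: indicator_def)
      then show "indicator ?A \<omega> \<le> exp (- r * b) * (\<Prod>j=1..n. exp (r * ?u (\<xi> j \<omega>)))"
        unfolding eq .
    qed
    show "integrable P (indicator ?A :: _ \<Rightarrow> real)"
    proof (rule integrable_const_bound)
      have bd1: "norm (indicator B x :: real) \<le> 1" for B and x :: 'a by (simp add: indicator_def)
      show "AE \<omega> in P. norm (indicator ?A \<omega> :: real) \<le> 1"
        by (rule AE_I2) (rule bd1)
      show "(indicator ?A :: _ \<Rightarrow> real) \<in> borel_measurable P"
        by (rule borel_measurable_indicator[OF A])
    qed
  qed
  also have "\<dots> = exp (- r * b) * (\<Prod>j=1..n. (LINT \<omega>|P. exp (r * ?u (\<xi> j \<omega>))))"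
    using pe by simp
  also have "(\<Prod>j=1..n. (LINT \<omega>|P. exp (r * ?u (\<xi> j \<omega>)))) = (\<Prod>j=1..n. (LINT \<omega>|P. exp (r * ?u (\<xi> 0 \<omega>))))"
    by (rule prod.cong[OF refl], rule integral_ident) simp
  also have "\<dots> = (LINT \<omega>|P. exp (r * ?u (\<xi> 0 \<omega>))) ^ n"
    by simp
  also have "exp (- r * b) * (LINT \<omega>|P. exp (r * ?u (\<xi> 0 \<omega>))) ^ n \<le> exp (- r * b) * exp (r\<^sup>2 + exp (r * c) * V (1 / r)) ^ n"
  proof (intro mult_left_mono power_mono)
    show "(LINT \<omega>|P. exp (r * ?u (\<xi> 0 \<omega>))) \<le> exp (r\<^sup>2 + exp (r * c) * V (1 / r))"
      using truncated_mgf[OF assms] exp_ge_add_one_self by (rule order_trans)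
  qed (auto intro: integral_nonneg)
  also have "\<dots> = exp (- r * b + real n * (r\<^sup>2 + exp (r * c) * V (1 / r)))"
    by (simp add: exp_of_nat_mult[symmetric] exp_add[symmetric])
  finally show ?thesis .
qed

lemma prob_disjoint_blocks:
  assumes "J \<inter> K = {}"
    and A: "A \<in> sets (PiM J (\<lambda>_. borel))" and B: "B \<in> sets (PiM K (\<lambda>_. borel))"
  shows "prob {\<omega> \<in> space P. (\<lambda>j\<in>J. \<xi> j \<omega>) \<in> A \<and> (\<lambda>j\<in>K. \<xi> j \<omega>) \<in> B} =
    prob {\<omega> \<in> space P. (\<lambda>j\<in>J. \<xi> j \<omega>) \<in> A} * prob {\<omega> \<in> space P. (\<lambda>j\<in>K. \<xi> j \<omega>) \<in> B}"
proof -
  have "indep_var (PiM J (\<lambda>_. borel)) (\<lambda>\<omega>. \<lambda>j\<in>J. \<xi> j \<omega>) (PiM K (\<lambda>_. borel)) (\<lambda>\<omega>. \<lambda>j\<in>K. \<xi> j \<omega>)"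
    using indep assms(1) by (rule indep_var_restrict) auto
  from indep_varD[OF this A B] show ?thesis
    by (simp add: vimage_def Int_def conj_ac)
qed

lemma prob_all_gt:
  assumes "finite J"
  shows "prob {\<omega> \<in> space P. \<forall>j\<in>J. \<xi> j \<omega> > c} = V c ^ card J"
proof (cases "J = {}")
  case True
  then show ?thesis by (simp add: prob_space)
next
  case False
  have "prob (\<Inter>j\<in>J. \<xi> j -` {c<..} \<inter> space P) = (\<Prod>j\<in>J. prob (\<xi> j -` {c<..} \<inter> space P))"
    using assms False by (intro indep_varsD[OF indep]) auto
  also have "(\<Inter>j\<in>J. \<xi> j -` {c<..} \<inter> space P) = {\<omega> \<in> space P. \<forall>j\<in>J. \<xi> j \<omega> > c}"
    using False by auto
  also have "(\<Prod>j\<in>J. prob (\<xi> j -` {c<..} \<inter> space P)) = (\<Prod>j\<in>J. V c)"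
    using prob_gt by (intro prod.cong) (auto simp: vimage_def Int_def conj_commute)
  finally show ?thesis by simp
qed

section \<open>The law of the big jumps\<close>

text \<open>The law of \<open>min (\<xi> / s) 1\<close> conditioned on \<open>\<xi> > d s\<close>.\<close>

definition excess_law :: "real \<Rightarrow> real \<Rightarrow> real measure" where
  "excess_law s d = distr (uniform_measure (distr P borel (\<xi> 0)) {d * s<..}) borel (\<lambda>x. min (x / s) 1)"

lemma measure_law_greaterThan: "measure (distr P borel (\<xi> 0)) {t<..} = V t"
  by (simp add: measure_distr right_tail_def vimage_def Int_def conj_commute)

lemma emeasure_law_greaterThan:
  "emeasure (distr P borel (\<xi> 0)) {t<..} \<noteq> 0" "emeasure (distr P borel (\<xi> 0)) {t<..} \<noteq> \<infinity>"
proof -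
  interpret D: prob_space "distr P borel (\<xi> 0)" by (rule prob_space_distr) simp
  show "emeasure (distr P borel (\<xi> 0)) {t<..} \<noteq> \<infinity>" by simp
  show "emeasure (distr P borel (\<xi> 0)) {t<..} \<noteq> 0"
    using V_pos[of t] measure_law_greaterThan[of t] by (auto simp: measure_def)
qed

lemma real_distribution_excess_law: "real_distribution (excess_law s d)"
proof -
  interpret U: prob_space "uniform_measure (distr P borel (\<xi> 0)) {d * s<..}"
    by (rule prob_space_uniform_measure) (rule emeasure_law_greaterThan)+
  show ?thesis unfolding excess_law_def by (rule U.real_distribution_distr) simp
qed

lemma excess_law_tail:
  assumes "s > 0"
  shows "measure (excess_law s d) {x<..} = (if x \<ge> 1 then 0 else V (max x d * s) / V (d * s))"
proof -
  have "measure (excess_law s d) {x<..} =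
      measure (uniform_measure (distr P borel (\<xi> 0)) {d * s<..}) {y. min (y / s) 1 > x}"
    unfolding excess_law_def by (subst measure_distr) (auto simp: vimage_def space_uniform_measure)
  also have "\<dots> = measure (distr P borel (\<xi> 0)) ({d * s<..} \<inter> {y. min (y / s) 1 > x}) / V (d * s)"
    by (subst measure_uniform_measure[OF emeasure_law_greaterThan]) (simp_all add: measure_law_greaterThan)
  also have "{d * s<..} \<inter> {y. min (y / s) 1 > x} = (if x \<ge> 1 then {} else {max x d * s<..})"
  proof -
    have "max x d * s = max (x * s) (d * s)" using assms by (simp add: max_mult_distrib_right)
    then show ?thesis using assms by (auto simp: field_simps)
  qed
  finally show ?thesis by (simp add: measure_law_greaterThan)
qed

lemma char_excess_law:
  "char (excess_law s d) t = (1 / V (d * s)) *\<^sub>R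
     (CLINT \<omega>|P. indicator {d * s<..} (\<xi> 0 \<omega>) *\<^sub>R iexp (t * min (\<xi> 0 \<omega> / s) 1))"
proof -
  have "char (excess_law s d) t =
      (CLINT x|uniform_measure (distr P borel (\<xi> 0)) {d * s<..}. iexp (t * min (x / s) 1))"
    unfolding char_def excess_law_def by (subst integral_distr) auto
  also have "\<dots> = (1 / V (d * s)) *\<^sub>R
      (CLINT x|distr P borel (\<xi> 0). indicator {d * s<..} x *\<^sub>R iexp (t * min (x / s) 1))"
    by (subst integral_uniform_measure[OF emeasure_law_greaterThan]) (simp_all add: measure_law_greaterThan)
  also have "(CLINT x|distr P borel (\<xi> 0). indicator {d * s<..} x *\<^sub>R iexp (t * min (x / s) 1))
      = (CLINT \<omega>|P. indicator {d * s<..} (\<xi> 0 \<omega>) *\<^sub>R iexp (t * min (\<xi> 0 \<omega> / s) 1))"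
    by (subst integral_distr) auto
  finally show ?thesis .
qed

text \<open>Conditionally on all summands in \<open>J\<close> being big, they are still independent, each with its conditional law, so
  the characteristic function of their sum is a power; this identifies the law of the sum.\<close>

lemma prob_big_jumps_sum:
  assumes "finite J" "s > 0"
  shows "prob {\<omega> \<in> space P. (\<forall>j\<in>J. \<xi> j \<omega> > d * s) \<and> (\<Sum>j\<in>J. min (\<xi> j \<omega>) s) > z * s}
    = V (d * s) ^ card J * measure (sum_law (card J) (excess_law s d)) {z<..}"
proof -
  let ?E = "{\<omega> \<in> space P. \<forall>j\<in>J. \<xi> j \<omega> > d * s}"
  let ?T = "\<lambda>\<omega>. \<Sum>j\<in>J. min (\<xi> j \<omega> / s) 1"
  have E [measurable]: "?E \<in> events" using assms by measurable
  have pE: "prob ?E = V (d * s) ^ card J" by (rule prob_all_gt) fact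
  have pos: "V (d * s) ^ card J > 0" using V_pos by simp
  have nz: "emeasure P ?E \<noteq> 0" "emeasure P ?E \<noteq> \<infinity>"
    using pE V_pos[of "d * s"] by (simp_all add: emeasure_eq_measure)
  interpret C: prob_space "uniform_measure P ?E" by (rule prob_space_uniform_measure[OF nz])
  have dist: "real_distribution (distr (uniform_measure P ?E) borel ?T)"
    by (rule C.real_distribution_distr) simp
  have "char (distr (uniform_measure P ?E) borel ?T) t = char (sum_law (card J) (excess_law s d)) t" for t
  proof -
    define g :: "real \<Rightarrow> complex" where
      "g x = indicator {d * s<..} x *\<^sub>R iexp (t * min (x / s) 1)" for x
    have [measurable]: "g \<in> borel_measurable borel" unfolding g_def by measurable
    have g_bd: "norm (g x) \<le> 1" for x by (auto simp: g_def indicator_def simp del: of_real_mult)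
    have gint: "integrable P (\<lambda>\<omega>. g (\<xi> j \<omega>))" for j
      by (rule integrable_const_bound[of _ 1]) (use g_bd in auto)
    have gind: "indep_vars (\<lambda>_. borel) (\<lambda>j \<omega>. g (\<xi> j \<omega>)) J"
      by (rule indep_vars_compose2[OF indep_vars_subset[OF indep]]) auto
    have split: "indicator ?E \<omega> *\<^sub>R iexp (t * ?T \<omega>) = (\<Prod>j\<in>J. g (\<xi> j \<omega>))" if w: "\<omega> \<in> space P" for \<omega>
    proof (cases "\<omega> \<in> ?E")
      case True
      then have "(\<Prod>j\<in>J. g (\<xi> j \<omega>)) = (\<Prod>j\<in>J. iexp (t * min (\<xi> j \<omega> / s) 1))"
        by (intro prod.cong) (auto simp: g_def)
      also have "\<dots> = iexp (t * ?T \<omega>)"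
        using assms by (simp add: exp_sum sum_distrib_left)
      finally show ?thesis using True by simp
    next
      case False
      then obtain j where "j \<in> J" "g (\<xi> j \<omega>) = 0" using w by (auto simp: g_def)
      then have "(\<Prod>j\<in>J. g (\<xi> j \<omega>)) = 0" using assms by (intro prod_zero) auto
      then show ?thesis using False by simp
    qed
    have "char (distr (uniform_measure P ?E) borel ?T) t = (CLINT \<omega>|uniform_measure P ?E. iexp (t * ?T \<omega>))"
      unfolding char_def by (subst integral_distr) auto
    also have "\<dots> = (1 / V (d * s) ^ card J) *\<^sub>R (CLINT \<omega>|P. indicator ?E \<omega> *\<^sub>R iexp (t * ?T \<omega>))"
      unfolding pE[symmetric] by (rule integral_uniform_measure[OF nz]) measurable
    also have "(CLINT \<omega>|P. indicator ?E \<omega> *\<^sub>R iexp (t * ?T \<omega>)) = (CLINT \<omega>|P. \<Prod>j\<in>J. g (\<xi> j \<omega>))"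
      by (rule Bochner_Integration.integral_cong[OF refl split])
    also have "\<dots> = (\<Prod>j\<in>J. CLINT \<omega>|P. g (\<xi> j \<omega>))"
      by (rule indep_vars_lebesgue_integral[OF assms(1) gind gint])
    also have "\<dots> = (\<Prod>j\<in>J. CLINT \<omega>|P. g (\<xi> 0 \<omega>))"
      by (rule prod.cong[OF refl], rule integral_ident) simp
    also have "(1 / V (d * s) ^ card J) *\<^sub>R (\<Prod>j\<in>J. CLINT \<omega>|P. g (\<xi> 0 \<omega>)) = char (excess_law s d) t ^ card J"
    proof -
      have "char (excess_law s d) t = (1 / V (d * s)) *\<^sub>R (CLINT \<omega>|P. g (\<xi> 0 \<omega>))"
        by (simp only: char_excess_law g_def)
      then show ?thesis by (simp add: scaleR_power power_one_over)
    qed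
    finally show ?thesis
      by (simp add: char_sum_law[OF real_distribution_excess_law])
  qed
  then have law: "distr (uniform_measure P ?E) borel ?T = sum_law (card J) (excess_law s d)"
    using dist real_distribution_sum_law[OF real_distribution_excess_law]
    by (intro Levy_uniqueness) auto
  have "measure (sum_law (card J) (excess_law s d)) {z<..} = measure (uniform_measure P ?E) {\<omega> \<in> space P. ?T \<omega> > z}"
    unfolding law[symmetric] by (subst measure_distr) (auto intro!: arg_cong[where f="measure _"])
  also have "\<dots> = prob (?E \<inter> {\<omega> \<in> space P. ?T \<omega> > z}) / V (d * s) ^ card J"
    unfolding pE[symmetric] by (rule measure_uniform_measure[OF nz]) measurable
  also have "?E \<inter> {\<omega> \<in> space P. ?T \<omega> > z} =
      {\<omega> \<in> space P. (\<forall>j\<in>J. \<xi> j \<omega> > d * s) \<and> (\<Sum>j\<in>J. min (\<xi> j \<omega>) s) > z * s}"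
  proof -
    have "min (x / s) 1 = min x s / s" for x using assms by (auto simp: min_def field_simps)
    then have "?T \<omega> = (\<Sum>j\<in>J. min (\<xi> j \<omega>) s) / s" for \<omega> by (simp add: sum_divide_distrib)
    then have "z < ?T \<omega> \<longleftrightarrow> z * s < (\<Sum>j\<in>J. min (\<xi> j \<omega>) s)" for \<omega>
      using assms by (simp add: pos_less_divide_eq)
    then show ?thesis by auto
  qed
  finally show ?thesis using V_pos[of "d * s"] by (simp add: field_simps)
qed

text \<open>This is the regular variation of \<open>V\<close>, read as convergence of distribution functions.\<close>

lemma weak_conv_excess_law:
  assumes S: "filterlim S at_top sequentially" and "d > 0"
  shows "weak_conv_m (\<lambda>n. excess_law (S n) d) (pareto_clipped \<alpha> d)"
  unfolding weak_conv_m_def weak_conv_def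
proof (intro allI impI)
  fix x
  have a: "\<alpha> > 0" using alpha by simp
  interpret R: real_distribution "pareto_clipped \<alpha> d"
    using a assms by (intro real_distribution_pareto_clipped)
  have tail_lim: "(\<lambda>n. measure (excess_law (S n) d) {x<..}) \<longlonglongrightarrow> measure (pareto_clipped \<alpha> d) {x<..}"
  proof (cases "x \<ge> 1")
    case True
    have "\<forall>\<^sub>F n in sequentially. measure (excess_law (S n) d) {x<..} = 0"
      using filterlim_at_top_dense[THEN iffD1, OF S, rule_format, of 0]
      by eventually_elim (use True in \<open>simp add: excess_law_tail\<close>)
    moreover have "measure (pareto_clipped \<alpha> d) {x<..} = 0"
      using True a assms by (simp add: measure_def emeasure_pareto_clipped_greaterThan)
    ultimately show ?thesis by (simp add: tendsto_eventually)
  next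
    case False
    let ?y = "max x d"
    have y: "?y > 0" using assms by simp
    have "(\<lambda>n. (V (S n * ?y) / V (S n)) / (V (S n * d) / V (S n))) \<longlonglongrightarrow> ?y powr (- \<alpha>) / d powr (- \<alpha>)"
      using assms y by (intro tendsto_divide filterlim_compose[OF V_ratio S]) auto
    moreover have "\<forall>\<^sub>F n in sequentially. (V (S n * ?y) / V (S n)) / (V (S n * d) / V (S n))
        = measure (excess_law (S n) d) {x<..}"
      using filterlim_at_top_dense[THEN iffD1, OF S, rule_format, of 0]
    proof eventually_elim
      case (elim n)
      have "V (S n) > 0" "V (S n * d) > 0" by (rule V_pos)+
      then show ?case using elim False by (simp add: excess_law_tail mult.commute)
    qed
    ultimately have "(\<lambda>n. measure (excess_law (S n) d) {x<..}) \<longlonglongrightarrow> ?y powr (- \<alpha>) / d powr (- \<alpha>)"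
      by (rule Lim_transform_eventually)
    also have "?y powr (- \<alpha>) / d powr (- \<alpha>) = measure (pareto_clipped \<alpha> d) {x<..}"
      using False a assms y by (simp add: measure_def emeasure_pareto_clipped_greaterThan powr_divide)
    finally show ?thesis .
  qed
  show "(\<lambda>n. cdf (excess_law (S n) d) x) \<longlonglongrightarrow> cdf (pareto_clipped \<alpha> d) x"
    unfolding R.cdf_eq_tail real_distribution.cdf_eq_tail[OF real_distribution_excess_law]
    by (intro tendsto_intros tail_lim)
qed

lemma big_jump_sum_limit:
  assumes "filterlim S at_top sequentially" "0 < d" "d < 1" "z \<notin> \<int>"
  shows "(\<lambda>n. measure (sum_law m (excess_law (S n) d)) {z<..}) \<longlonglongrightarrow> measure (sum_law m (pareto_clipped \<alpha> d)) {z<..}"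
proof -
  have a: "\<alpha> > 0" using alpha by simp
  note Q = real_distribution_pareto_clipped[OF a assms(2)]
  interpret R: real_distribution "sum_law m (pareto_clipped \<alpha> d)" by (rule real_distribution_sum_law[OF Q])
  have "weak_conv_m (\<lambda>n. sum_law m (excess_law (S n) d)) (sum_law m (pareto_clipped \<alpha> d))"
    by (intro weak_conv_sum_law real_distribution_excess_law Q weak_conv_excess_law assms)
  moreover have "isCont (cdf (sum_law m (pareto_clipped \<alpha> d))) z"
    unfolding R.isCont_cdf using pareto_sum_law_no_atoms[OF a assms(2-4)] by (simp add: measure_def)
  ultimately have "(\<lambda>n. cdf (sum_law m (excess_law (S n) d)) z) \<longlonglongrightarrow> cdf (sum_law m (pareto_clipped \<alpha> d)) z"
    by (auto simp: weak_conv_m_def weak_conv_def)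
  then have "(\<lambda>n. 1 - cdf (sum_law m (excess_law (S n) d)) z) \<longlonglongrightarrow> 1 - cdf (sum_law m (pareto_clipped \<alpha> d)) z"
    by (intro tendsto_intros)
  then show ?thesis
    by (simp add: R.cdf_eq_tail real_distribution.cdf_eq_tail[OF real_distribution_sum_law[OF real_distribution_excess_law]])
qed

section \<open>Splitting the event by the number of big jumps\<close>

text \<open>The sum over the indices outside \<open>J\<close> is independent of the jumps in \<open>J\<close> and is controlled by its variance.\<close>

lemma prob_big_jumps_small_rest_ge:
  assumes "J \<subseteq> {1..n}" "b > 0" "s > 0"
  shows "prob {\<omega> \<in> space P. (\<forall>j\<in>J. \<xi> j \<omega> > d * s) \<and> (\<Sum>j\<in>{1..n} - J. \<xi> j \<omega>) \<ge> b * s}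
    \<le> V (d * s) ^ card J * (real n / (b * s)\<^sup>2)"
proof -
  let ?K = "{1..n} - J"
  have fin: "finite J" using assms finite_subset by blast
  let ?A = "{x \<in> space (PiM J (\<lambda>_. borel)). \<forall>j\<in>J. x j > d * s} :: (nat \<Rightarrow> real) set"
  let ?B = "{x \<in> space (PiM ?K (\<lambda>_. borel)). (\<Sum>j\<in>?K. x j) \<ge> b * s} :: (nat \<Rightarrow> real) set"
  have A: "?A \<in> sets (PiM J (\<lambda>_. borel))" using fin by measurable
  have B: "?B \<in> sets (PiM ?K (\<lambda>_. borel))" by measurable
  have "prob {\<omega> \<in> space P. (\<lambda>j\<in>J. \<xi> j \<omega>) \<in> ?A \<and> (\<lambda>j\<in>?K. \<xi> j \<omega>) \<in> ?B} =
      prob {\<omega> \<in> space P. (\<lambda>j\<in>J. \<xi> j \<omega>) \<in> ?A} * prob {\<omega> \<in> space P. (\<lambda>j\<in>?K. \<xi> j \<omega>) \<in> ?B}"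
    using A B by (intro prob_disjoint_blocks) auto
  then have "prob {\<omega> \<in> space P. (\<forall>j\<in>J. \<xi> j \<omega> > d * s) \<and> (\<Sum>j\<in>?K. \<xi> j \<omega>) \<ge> b * s} =
      prob {\<omega> \<in> space P. \<forall>j\<in>J. \<xi> j \<omega> > d * s} * prob {\<omega> \<in> space P. (\<Sum>j\<in>?K. \<xi> j \<omega>) \<ge> b * s}"
    by (simp add: space_PiM)
  also have "\<dots> \<le> V (d * s) ^ card J * (real n / (b * s)\<^sup>2)"
  proof (rule mult_mono)
    show "prob {\<omega> \<in> space P. \<forall>j\<in>J. \<xi> j \<omega> > d * s} \<le> V (d * s) ^ card J"
      using prob_all_gt[OF fin] by simp
    have "prob {\<omega> \<in> space P. (\<Sum>j\<in>?K. \<xi> j \<omega>) \<ge> b * s} \<le> prob {\<omega> \<in> space P. \<bar>\<Sum>j\<in>?K. \<xi> j \<omega>\<bar> \<ge> b * s}"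
      by (intro finite_measure_mono) auto
    also have "\<dots> \<le> real (card ?K) / (b * s)\<^sup>2"
      using assms by (intro sum_Chebyshev) auto
    also have "\<dots> \<le> real n / (b * s)\<^sup>2"
      using card_mono[of "{1..n}" ?K] by (intro divide_right_mono) auto
    finally show "prob {\<omega> \<in> space P. (\<Sum>j\<in>?K. \<xi> j \<omega>) \<ge> b * s} \<le> real n / (b * s)\<^sup>2" .
  qed (use V_nonneg in auto)
  finally show ?thesis .
qed

lemma prob_big_jumps_small_rest:
  assumes "J \<subseteq> {1..n}" "b > 0" "s > 0"
  shows "prob {\<omega> \<in> space P. ((\<forall>j\<in>J. \<xi> j \<omega> > d * s) \<and> (\<Sum>j\<in>J. min (\<xi> j \<omega>) s) > z * s) \<and>
        (\<forall>j\<in>{1..n} - J. \<xi> j \<omega> \<le> d * s) \<and> (\<Sum>j\<in>{1..n} - J. \<xi> j \<omega>) > - (b * s)}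
    \<ge> V (d * s) ^ card J * measure (sum_law (card J) (excess_law s d)) {z<..} *
       (1 - real n * V (d * s) - real n / (b * s)\<^sup>2)"
proof -
  let ?K = "{1..n} - J"
  have fin: "finite J" using assms finite_subset by blast
  have cK: "real (card ?K) \<le> real n" using card_mono[of "{1..n}" ?K] by auto
  let ?A = "{x \<in> space (PiM J (\<lambda>_. borel)). (\<forall>j\<in>J. x j > d * s) \<and> (\<Sum>j\<in>J. min (x j) s) > z * s} :: (nat \<Rightarrow> real) set"
  let ?B = "{x \<in> space (PiM ?K (\<lambda>_. borel)). (\<forall>j\<in>?K. x j \<le> d * s) \<and> (\<Sum>j\<in>?K. x j) > - (b * s)} :: (nat \<Rightarrow> real) set"
  let ?B' = "{\<omega> \<in> space P. (\<forall>j\<in>?K. \<xi> j \<omega> \<le> d * s) \<and> (\<Sum>j\<in>?K. \<xi> j \<omega>) > - (b * s)}"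
  have A: "?A \<in> sets (PiM J (\<lambda>_. borel))" using fin by measurable
  have B: "?B \<in> sets (PiM ?K (\<lambda>_. borel))" by measurable
  have B': "?B' \<in> events" by measurable
  have "prob {\<omega> \<in> space P. (\<lambda>j\<in>J. \<xi> j \<omega>) \<in> ?A \<and> (\<lambda>j\<in>?K. \<xi> j \<omega>) \<in> ?B} =
      prob {\<omega> \<in> space P. (\<lambda>j\<in>J. \<xi> j \<omega>) \<in> ?A} * prob {\<omega> \<in> space P. (\<lambda>j\<in>?K. \<xi> j \<omega>) \<in> ?B}"
    using A B by (intro prob_disjoint_blocks) auto
  then have "prob {\<omega> \<in> space P. ((\<forall>j\<in>J. \<xi> j \<omega> > d * s) \<and> (\<Sum>j\<in>J. min (\<xi> j \<omega>) s) > z * s) \<and>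
        (\<forall>j\<in>?K. \<xi> j \<omega> \<le> d * s) \<and> (\<Sum>j\<in>?K. \<xi> j \<omega>) > - (b * s)} =
      prob {\<omega> \<in> space P. (\<forall>j\<in>J. \<xi> j \<omega> > d * s) \<and> (\<Sum>j\<in>J. min (\<xi> j \<omega>) s) > z * s} * prob ?B'"
    by (simp add: space_PiM)
  also have "prob {\<omega> \<in> space P. (\<forall>j\<in>J. \<xi> j \<omega> > d * s) \<and> (\<Sum>j\<in>J. min (\<xi> j \<omega>) s) > z * s}
      = V (d * s) ^ card J * measure (sum_law (card J) (excess_law s d)) {z<..}"
    by (rule prob_big_jumps_sum) fact+
  finally have eq: "prob {\<omega> \<in> space P. ((\<forall>j\<in>J. \<xi> j \<omega> > d * s) \<and> (\<Sum>j\<in>J. min (\<xi> j \<omega>) s) > z * s) \<and>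
        (\<forall>j\<in>?K. \<xi> j \<omega> \<le> d * s) \<and> (\<Sum>j\<in>?K. \<xi> j \<omega>) > - (b * s)} =
      V (d * s) ^ card J * measure (sum_law (card J) (excess_law s d)) {z<..} * prob ?B'" .
  have "1 - prob ?B' = prob (space P - ?B')" using prob_compl[OF B'] by simp
  also have "\<dots> \<le> prob ((\<Union>j\<in>?K. {\<omega> \<in> space P. \<xi> j \<omega> > d * s}) \<union> {\<omega> \<in> space P. \<bar>\<Sum>j\<in>?K. \<xi> j \<omega>\<bar> \<ge> b * s})"
    by (intro finite_measure_mono) (auto simp: not_le not_less)
  also have "\<dots> \<le> prob (\<Union>j\<in>?K. {\<omega> \<in> space P. \<xi> j \<omega> > d * s}) + prob {\<omega> \<in> space P. \<bar>\<Sum>j\<in>?K. \<xi> j \<omega>\<bar> \<ge> b * s}"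
    by (intro measure_Un_le) auto
  also have "\<dots> \<le> (\<Sum>j\<in>?K. prob {\<omega> \<in> space P. \<xi> j \<omega> > d * s}) + real (card ?K) / (b * s)\<^sup>2"
    using assms by (intro add_mono finite_measure_subadditive_finite sum_Chebyshev) auto
  also have "(\<Sum>j\<in>?K. prob {\<omega> \<in> space P. \<xi> j \<omega> > d * s}) = real (card ?K) * V (d * s)"
    by (simp add: prob_gt)
  also have "real (card ?K) * V (d * s) + real (card ?K) / (b * s)\<^sup>2 \<le> real n * V (d * s) + real n / (b * s)\<^sup>2"
    using cK V_nonneg by (intro add_mono mult_right_mono divide_right_mono) auto
  finally have "1 - real n * V (d * s) - real n / (b * s)\<^sup>2 \<le> prob ?B'" by simp
  then show ?thesis
    unfolding eq using V_nonneg by (intro mult_left_mono mult_nonneg_nonneg) auto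
qed

text \<open>Three cases for the set of indices \<open>j\<close> with \<open>\<xi>\<^sub>j > d s\<close>.  Fewer than \<open>k\<close> such jumps contribute at most
  \<open>(k - 1) s\<close>, and the small summands must supply the rest; with more than \<open>k\<close>, some \<open>k + 1\<close> indices jump; with
  exactly \<open>k\<close>, either the jumps exceed \<open>(z - b) s\<close> or the rest exceeds \<open>b s\<close>.\<close>

lemma prob_censored_sum_le:
  assumes "s > 0" "0 < d" "b > 0" "k \<ge> 1"
  shows "prob {\<omega> \<in> space P. (\<Sum>j=1..n. min (\<xi> j \<omega>) s) > z * s} \<le>
      prob {\<omega> \<in> space P. (\<Sum>j=1..n. if \<xi> j \<omega> \<le> d * s then \<xi> j \<omega> else 0) > (z - (real k - 1)) * s}
    + real (n choose Suc k) * V (d * s) ^ Suc k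
    + real (n choose k) * (V (d * s) ^ k *
        (measure (sum_law k (excess_law s d)) {z - b<..} + real n / (b * s)\<^sup>2))"
proof -
  let ?N = "\<lambda>m. {J. J \<subseteq> {1..n} \<and> card J = m}"
  let ?E = "\<lambda>J. {\<omega> \<in> space P. \<forall>j\<in>J. \<xi> j \<omega> > d * s}"
  let ?U0 = "{\<omega> \<in> space P. (\<Sum>j=1..n. if \<xi> j \<omega> \<le> d * s then \<xi> j \<omega> else 0) > (z - (real k - 1)) * s}"
  let ?T = "\<lambda>J. {\<omega> \<in> space P. (\<forall>j\<in>J. \<xi> j \<omega> > d * s) \<and> (\<Sum>j\<in>J. min (\<xi> j \<omega>) s) > (z - b) * s}"
  let ?R = "\<lambda>J. {\<omega> \<in> space P. (\<forall>j\<in>J. \<xi> j \<omega> > d * s) \<and> (\<Sum>j\<in>{1..n} - J. \<xi> j \<omega>) \<ge> b * s}"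
  have finN: "finite (?N m)" for m by (rule finite_subset[of _ "Pow {1..n}"]) auto
  have finJ: "finite J" if "J \<in> ?N m" for J m using that finite_subset by blast
  have cardN: "card (?N m) = n choose m" for m using n_subsets[of "{1..n}" m] by simp
  have mE: "?E J \<in> events" if "J \<in> ?N m" for J m using finJ[OF that] by measurable
  have mT: "?T J \<in> events" if "J \<in> ?N m" for J m using finJ[OF that] by measurable
  have mR: "?R J \<in> events" if "J \<in> ?N m" for J m using finJ[OF that] by measurable
  have "{\<omega> \<in> space P. (\<Sum>j=1..n. min (\<xi> j \<omega>) s) > z * s} \<subseteq>
      ?U0 \<union> (\<Union>J\<in>?N (Suc k). ?E J) \<union> (\<Union>J\<in>?N k. ?T J \<union> ?R J)"
  proof
    fix \<omega> assume "\<omega> \<in> {\<omega> \<in> space P. (\<Sum>j=1..n. min (\<xi> j \<omega>) s) > z * s}"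
    then have \<omega>: "\<omega> \<in> space P" and Y: "(\<Sum>j=1..n. min (\<xi> j \<omega>) s) > z * s" by auto
    define J where "J = {j \<in> {1..n}. \<xi> j \<omega> > d * s}"
    have J: "J \<subseteq> {1..n}" "finite J" by (auto simp: J_def)
    have split: "(\<Sum>j=1..n. min (\<xi> j \<omega>) s) = (\<Sum>j\<in>{1..n} - J. min (\<xi> j \<omega>) s) + (\<Sum>j\<in>J. min (\<xi> j \<omega>) s)"
      by (rule sum.subset_diff[OF J(1)]) simp
    have rest: "(\<Sum>j\<in>{1..n} - J. min (\<xi> j \<omega>) s) \<le> (\<Sum>j\<in>{1..n} - J. \<xi> j \<omega>)"
      by (intro sum_mono) auto
    consider "card J < k" | "card J = k" | "card J \<ge> Suc k" by linarith
    then show "\<omega> \<in> ?U0 \<union> (\<Union>J\<in>?N (Suc k). ?E J) \<union> (\<Union>J\<in>?N k. ?T J \<union> ?R J)"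
    proof cases
      case 1
      have "(\<Sum>j\<in>J. min (\<xi> j \<omega>) s) \<le> (\<Sum>j\<in>J. s)" by (intro sum_mono) auto
      also have "\<dots> = real (card J) * s" by simp
      also have "\<dots> \<le> (real k - 1) * s" using 1 assms by (intro mult_right_mono) auto
      finally have "(\<Sum>j\<in>{1..n} - J. \<xi> j \<omega>) > (z - (real k - 1)) * s"
        using Y split rest by (simp add: algebra_simps)
      also have "(\<Sum>j\<in>{1..n} - J. \<xi> j \<omega>) = (\<Sum>j=1..n. if \<xi> j \<omega> \<le> d * s then \<xi> j \<omega> else 0)"
        unfolding J_def by (intro sum.mono_neutral_cong_left) auto
      finally show ?thesis using \<omega> by simp
    next
      case 2
      have "(\<Sum>j\<in>J. min (\<xi> j \<omega>) s) > (z - b) * s \<or> (\<Sum>j\<in>{1..n} - J. \<xi> j \<omega>) \<ge> b * s"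
        using Y split rest by (auto simp: algebra_simps)
      then have "\<omega> \<in> ?T J \<union> ?R J" using \<omega> by (auto simp: J_def)
      then show ?thesis using J 2 by blast
    next
      case 3
      then obtain K where "K \<subseteq> J" "card K = Suc k" by (meson obtain_subset_with_card_n)
      then have "K \<in> ?N (Suc k)" "\<omega> \<in> ?E K" using J \<omega> by (auto simp: J_def)
      then show ?thesis by blast
    qed
  qed
  then have "prob {\<omega> \<in> space P. (\<Sum>j=1..n. min (\<xi> j \<omega>) s) > z * s} \<le>
      prob (?U0 \<union> (\<Union>J\<in>?N (Suc k). ?E J) \<union> (\<Union>J\<in>?N k. ?T J \<union> ?R J))"
    using finN mE mT mR by (intro finite_measure_mono sets.Un sets.finite_UN) auto
  also have "\<dots> \<le> prob (?U0 \<union> (\<Union>J\<in>?N (Suc k). ?E J)) + prob (\<Union>J\<in>?N k. ?T J \<union> ?R J)"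
    using finN mE mT mR by (intro measure_Un_le sets.Un sets.finite_UN) auto
  also have "prob (?U0 \<union> (\<Union>J\<in>?N (Suc k). ?E J)) \<le> prob ?U0 + prob (\<Union>J\<in>?N (Suc k). ?E J)"
    using finN mE by (intro measure_Un_le sets.finite_UN) auto
  also have "prob (\<Union>J\<in>?N (Suc k). ?E J) \<le> (\<Sum>J\<in>?N (Suc k). prob (?E J))"
    using finN mE by (intro finite_measure_subadditive_finite) auto
  also have "(\<Sum>J\<in>?N (Suc k). prob (?E J)) = (\<Sum>J\<in>?N (Suc k). V (d * s) ^ Suc k)"
    using finJ prob_all_gt by (intro sum.cong) auto
  also have "\<dots> = real (n choose Suc k) * V (d * s) ^ Suc k"
    by (simp only: sum_constant cardN)
  also have "prob (\<Union>J\<in>?N k. ?T J \<union> ?R J) \<le> (\<Sum>J\<in>?N k. prob (?T J \<union> ?R J))"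
    using finN mT mR by (intro finite_measure_subadditive_finite) auto
  also have "(\<Sum>J\<in>?N k. prob (?T J \<union> ?R J)) \<le> (\<Sum>J\<in>?N k. V (d * s) ^ k *
        (measure (sum_law k (excess_law s d)) {z - b<..} + real n / (b * s)\<^sup>2))"
  proof (rule sum_mono)
    fix J assume J: "J \<in> ?N k"
    then have "prob (?T J \<union> ?R J) \<le> prob (?T J) + prob (?R J)"
      using mT mR by (intro measure_Un_le) auto
    also have "prob (?T J) = V (d * s) ^ k * measure (sum_law k (excess_law s d)) {z - b<..}"
      using J finJ[OF J] assms prob_big_jumps_sum[of J s d "z - b"] by auto
    also have "prob (?R J) \<le> V (d * s) ^ k * (real n / (b * s)\<^sup>2)"
      using J assms prob_big_jumps_small_rest_ge[of J n b s d] by auto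
    finally show "prob (?T J \<union> ?R J) \<le> V (d * s) ^ k *
        (measure (sum_law k (excess_law s d)) {z - b<..} + real n / (b * s)\<^sup>2)"
      by (simp add: distrib_left)
  qed
  also have "\<dots> = real (n choose k) * (V (d * s) ^ k *
        (measure (sum_law k (excess_law s d)) {z - b<..} + real n / (b * s)\<^sup>2))"
    by (simp only: sum_constant cardN)
  finally show ?thesis by simp
qed

text \<open>For distinct index sets \<open>J\<close> the events that the big jumps occur exactly on \<open>J\<close> are disjoint, so their
  probabilities add up; no summand outside \<open>J\<close> is censored because \<open>d s \<le> s\<close>.\<close>

lemma prob_censored_sum_ge:
  assumes "s > 0" "0 < d" "d \<le> 1" "b > 0"
  shows "prob {\<omega> \<in> space P. (\<Sum>j=1..n. min (\<xi> j \<omega>) s) > z * s} \<ge>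
     real (n choose k) * (V (d * s) ^ k * measure (sum_law k (excess_law s d)) {z + b<..} *
       (1 - real n * V (d * s) - real n / (b * s)\<^sup>2))"
proof -
  let ?N = "{J. J \<subseteq> {1..n} \<and> card J = k}"
  let ?F = "\<lambda>J. {\<omega> \<in> space P. ((\<forall>j\<in>J. \<xi> j \<omega> > d * s) \<and> (\<Sum>j\<in>J. min (\<xi> j \<omega>) s) > (z + b) * s) \<and>
        (\<forall>j\<in>{1..n} - J. \<xi> j \<omega> \<le> d * s) \<and> (\<Sum>j\<in>{1..n} - J. \<xi> j \<omega>) > - (b * s)}"
  have finN: "finite ?N" by (rule finite_subset[of _ "Pow {1..n}"]) auto
  have finJ: "finite J" if "J \<in> ?N" for J using that finite_subset by blast
  have cardN: "card ?N = n choose k" using n_subsets[of "{1..n}" k] by simp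
  have mF: "?F J \<in> events" if "J \<in> ?N" for J using finJ[OF that] by measurable
  have disj: "disjoint_family_on ?F ?N"
    unfolding disjoint_family_on_def
  proof (intro ballI impI)
    fix J K assume JK: "J \<in> ?N" "K \<in> ?N" "J \<noteq> K"
    have eq: "I = {j \<in> {1..n}. \<xi> j \<omega> > d * s}" if "I \<in> ?N" "\<omega> \<in> ?F I" for I \<omega>
      using that by (auto simp: not_less[symmetric])
    show "?F J \<inter> ?F K = {}" using eq[OF JK(1)] eq[OF JK(2)] JK(3) by blast
  qed
  have "real (n choose k) * (V (d * s) ^ k * measure (sum_law k (excess_law s d)) {z + b<..} *
       (1 - real n * V (d * s) - real n / (b * s)\<^sup>2)) = (\<Sum>J\<in>?N. V (d * s) ^ k *
       measure (sum_law k (excess_law s d)) {z + b<..} * (1 - real n * V (d * s) - real n / (b * s)\<^sup>2))"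
    by (simp only: sum_constant cardN)
  also have "\<dots> \<le> (\<Sum>J\<in>?N. prob (?F J))"
    using assms prob_big_jumps_small_rest[of _ n b s d "z + b"] by (intro sum_mono) auto
  also have "\<dots> = prob (\<Union>J\<in>?N. ?F J)"
    using finN mF disj by (intro finite_measure_finite_Union[symmetric]) auto
  also have "\<dots> \<le> prob {\<omega> \<in> space P. (\<Sum>j=1..n. min (\<xi> j \<omega>) s) > z * s}"
  proof (rule finite_measure_mono)
    show "(\<Union>J\<in>?N. ?F J) \<subseteq> {\<omega> \<in> space P. (\<Sum>j=1..n. min (\<xi> j \<omega>) s) > z * s}"
    proof
      fix \<omega> assume "\<omega> \<in> (\<Union>J\<in>?N. ?F J)"
      then obtain J where J: "J \<in> ?N" and w: "\<omega> \<in> ?F J" by blast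
      have "d * s \<le> 1 * s" using assms by (intro mult_right_mono) auto
      then have "(\<Sum>j\<in>{1..n} - J. min (\<xi> j \<omega>) s) = (\<Sum>j\<in>{1..n} - J. \<xi> j \<omega>)"
        using w by (intro sum.cong refl min_absorb1) (force intro: order_trans[of _ "d * s"])
      moreover have "(\<Sum>j=1..n. min (\<xi> j \<omega>) s) = (\<Sum>j\<in>{1..n} - J. min (\<xi> j \<omega>) s) + (\<Sum>j\<in>J. min (\<xi> j \<omega>) s)"
        using J by (intro sum.subset_diff) auto
      ultimately show "\<omega> \<in> {\<omega> \<in> space P. (\<Sum>j=1..n. min (\<xi> j \<omega>) s) > z * s}"
        using w by (auto simp: algebra_simps)
    qed
  qed measurable
  finally show ?thesis .
qed

end

section \<open>Asymptotics along the censoring thresholds\<close>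

lemma binomial_over_power_limit: "(\<lambda>n. real (n choose k) / real n ^ k) \<longlonglongrightarrow> 1 / fact k"
proof (induction k)
  case (Suc k)
  have rec: "real (n choose Suc k) / real n ^ Suc k
      = (real (n choose k) / real n ^ k) * (1 - real k / real n) / real (Suc k)" if "n > 0" for n
  proof -
    have "real n * real (n choose k) = real k * real (n choose k) + real (Suc k) * real (n choose Suc k)"
      using gbinomial_mult_1[of "real n" k] by (simp add: binomial_gbinomial)
    then have eq: "real (n choose Suc k) = (real n - real k) * real (n choose k) / real (Suc k)"
      by (simp add: left_diff_distrib del: of_nat_Suc)
    have "1 - real k / real n = (real n - real k) / real n"
      using that by (simp add: diff_divide_distrib)
    then show ?thesis unfolding eq by (simp add: mult_ac del: of_nat_Suc)
  qed
  have "(\<lambda>n. (real (n choose k) / real n ^ k) * (1 - real k / real n) / real (Suc k))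
      \<longlonglongrightarrow> (1 / fact k) * (1 - 0) / real (Suc k)"
    by (intro tendsto_intros Suc lim_const_over_n) auto
  then have "(\<lambda>n. real (n choose Suc k) / real n ^ Suc k) \<longlonglongrightarrow> (1 / fact k) * (1 - 0) / real (Suc k)"
    by (rule Lim_transform_eventually)
       (use eventually_gt_at_top[of 0] in \<open>eventually_elim, simp add: rec del: power_Suc binomial_Suc_Suc\<close>)
  then show ?case by (simp add: field_simps)
qed simp

text \<open>For \<open>M n \<le> n\<close> the quotient is at most \<open>n ln n / (M n)\<^sup>2\<close>, a constant times \<open>(s\<^sub>n / M n)\<^sup>2\<close>; for \<open>M n > n\<close> it
  is at most \<open>ln (M n) / M n\<close>.\<close>

lemma dominates_s_seq_growth:
  assumes "dominates M (s_seq \<alpha>)" "\<alpha> > 2"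
  shows "filterlim M at_top sequentially" "(\<lambda>n. real n * ln (M n) / (M n)\<^sup>2) \<longlonglongrightarrow> 0"
proof -
  have pos: "\<forall>\<^sub>F n in sequentially. M n > 0" and lim: "(\<lambda>n. s_seq \<alpha> n / M n) \<longlonglongrightarrow> 0"
    using assms(1) by (auto simp: dominates_def)
  have sq: "(s_seq \<alpha> n)\<^sup>2 = (\<alpha> - 2) * (real n * ln (real n))" if "n \<ge> 1" for n
    using that assms(2) by (simp add: s_seq_def)
  have lim2: "(\<lambda>n. real n * ln (real n) / (M n)\<^sup>2) \<longlonglongrightarrow> 0"
  proof -
    have "(\<lambda>n. (s_seq \<alpha> n / M n)\<^sup>2 / (\<alpha> - 2)) \<longlonglongrightarrow> 0\<^sup>2 / (\<alpha> - 2)"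
      using assms(2) by (intro tendsto_intros lim) auto
    then have "(\<lambda>n. real n * ln (real n) / (M n)\<^sup>2) \<longlonglongrightarrow> 0\<^sup>2 / (\<alpha> - 2)"
    proof (rule Lim_transform_eventually)
      show "\<forall>\<^sub>F n in sequentially. (s_seq \<alpha> n / M n)\<^sup>2 / (\<alpha> - 2) = real n * ln (real n) / (M n)\<^sup>2"
        using eventually_ge_at_top[of 1]
        by eventually_elim (use assms(2) in \<open>simp add: power_divide sq\<close>)
    qed
    then show ?thesis by simp
  qed
  have "\<forall>\<^sub>F n in sequentially. real n * ln (real n) / (M n)\<^sup>2 < 1"
    by (rule order_tendstoD(2)[OF lim2]) simp
  then have ev: "\<forall>\<^sub>F n in sequentially. sqrt (real n) \<le> M n"
    using pos eventually_ge_at_top[of 3]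
  proof eventually_elim
    case (elim n)
    have "ln (real n) \<ge> 1"
    proof -
      have "real n \<ge> 3" using elim(3) by simp
      then have "exp 1 \<le> real n" using exp_le by linarith
      then show ?thesis using elim(3) by (subst ln_ge_iff) auto
    qed
    then have "real n * 1 \<le> real n * ln (real n)" by (intro mult_left_mono) auto
    also have "\<dots> \<le> (M n)\<^sup>2" using elim by (simp add: field_simps)
    finally show ?case using elim by (simp add: real_le_rsqrt real_sqrt_le_iff' sqrt_le_D real_le_lsqrt)
  qed
  show M: "filterlim M at_top sequentially"
    by (rule filterlim_at_top_mono[OF filterlim_compose[OF sqrt_at_top filterlim_real_sequentially] ev])
  have lim3: "(\<lambda>n. real n * ln (real n) / (M n)\<^sup>2 + ln (M n) / M n) \<longlonglongrightarrow> 0"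
    using tendsto_add[OF lim2 filterlim_compose[OF ln_x_over_x_tendsto_0 M]] by simp
  show "(\<lambda>n. real n * ln (M n) / (M n)\<^sup>2) \<longlonglongrightarrow> 0"
  proof (rule tendsto_sandwich[OF _ _ tendsto_const lim3])
    have M1: "\<forall>\<^sub>F n in sequentially. M n \<ge> 1"
      using M by (simp add: filterlim_at_top)
    then show "\<forall>\<^sub>F n in sequentially. 0 \<le> real n * ln (M n) / (M n)\<^sup>2"
      by eventually_elim simp
    show "\<forall>\<^sub>F n in sequentially. real n * ln (M n) / (M n)\<^sup>2 \<le> real n * ln (real n) / (M n)\<^sup>2 + ln (M n) / M n"
      using M1 eventually_ge_at_top[of 1]
    proof eventually_elim
      case (elim n)
      show ?case
      proof (cases "M n \<le> real n")
        case True
        then have "real n * ln (M n) / (M n)\<^sup>2 \<le> real n * ln (real n) / (M n)\<^sup>2"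
          using elim by (intro divide_right_mono mult_left_mono) auto
        moreover have "ln (M n) / M n \<ge> 0" using elim by simp
        ultimately show ?thesis by linarith
      next
        case False
        then have "real n * ln (M n) / (M n)\<^sup>2 \<le> M n * ln (M n) / (M n)\<^sup>2"
          using elim by (intro divide_right_mono mult_right_mono) auto
        also have "\<dots> = ln (M n) / M n" using elim by (simp add: power2_eq_square)
        moreover have "real n * ln (real n) / (M n)\<^sup>2 \<ge> 0" using elim by simp
        ultimately show ?thesis by linarith
      qed
    qed
  qed
qed

text \<open>The limit of \<open>P(Y\<^sub>n > z M\<^sub>n) k! / \<Pi>\<^sub>n\<^sup>k\<close>.\<close>

definition jump_profile :: "real \<Rightarrow> nat \<Rightarrow> real \<Rightarrow> real" where
  "jump_profile \<alpha> k z = (\<Sum>j=0..k. real (k choose j) * W_fun \<alpha> (k - j) (z - real j))"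

lemma between_consecutive_not_Ints:
  assumes "real k - 1 < z" "z < real k"
  shows "z \<notin> \<int>"
proof
  assume "z \<in> \<int>"
  then obtain i where "z = of_int i" by (auto elim: Ints_cases)
  with assms have "of_int (int k - 1) < (of_int i :: real)" "(of_int i :: real) < of_int (int k)" by auto
  then show False by (simp only: of_int_less_iff)
qed

lemma jump_profile_eq_pareto_sum:
  assumes "\<alpha> > 0" "0 < d" "d < 1" "real k - 1 + d < z" "z < real k"
  shows "jump_profile \<alpha> k z = measure (sum_law k (pareto_clipped \<alpha> d)) {z<..} / (d powr \<alpha>) ^ k"
  using measure_pareto_sum_tail[OF assms] assms by (simp add: jump_profile_def)

text \<open>Near a given point the profile is, for a small cut-off \<open>d\<close>, the rescaled tail of the clipped Pareto sum, which
  has no atoms off the integers.\<close>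

lemma continuous_on_jump_profile:
  assumes "\<alpha> > 0"
  shows "continuous_on {real k - 1<..<real k} (jump_profile \<alpha> k)"
  unfolding continuous_on_eq_continuous_at[OF open_greaterThanLessThan]
proof
  fix z assume z: "z \<in> {real k - 1<..<real k}"
  define d where "d = min ((z - (real k - 1)) / 2) (1 / 2)"
  have d: "0 < d" "d < 1" "real k - 1 + d < z" using z by (auto simp: d_def min_def field_simps)
  note Q = real_distribution_pareto_clipped[OF assms d(1)]
  interpret R: real_distribution "sum_law k (pareto_clipped \<alpha> d)" by (rule real_distribution_sum_law[OF Q])
  have "isCont (cdf (sum_law k (pareto_clipped \<alpha> d))) z"
    unfolding R.isCont_cdf
    using pareto_sum_law_no_atoms[OF assms d(1,2) between_consecutive_not_Ints[of k z]] z
    by (simp add: measure_def)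
  then have "isCont (\<lambda>z. (1 - cdf (sum_law k (pareto_clipped \<alpha> d)) z) / (d powr \<alpha>) ^ k) z"
    using d by (intro continuous_intros) auto
  moreover have "\<forall>\<^sub>F u in nhds z. jump_profile \<alpha> k u = (1 - cdf (sum_law k (pareto_clipped \<alpha> d)) u) / (d powr \<alpha>) ^ k"
  proof (rule eventually_nhds_in_open[of "{real k - 1 + d<..<real k}", THEN eventually_mono])
    show "jump_profile \<alpha> k u = (1 - cdf (sum_law k (pareto_clipped \<alpha> d)) u) / (d powr \<alpha>) ^ k"
      if "u \<in> {real k - 1 + d<..<real k}" for u
      using that assms d by (subst jump_profile_eq_pareto_sum[of \<alpha> d]) (auto simp: R.cdf_eq_tail)
  qed (use z d in auto)
  ultimately show "isCont (jump_profile \<alpha> k) z" by (simp add: isCont_cong)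
qed

lemma jump_profile_ge_1:
  assumes "\<alpha> > 0"
  shows "jump_profile \<alpha> k z \<ge> 1"
proof -
  have W: "W_fun \<alpha> m u \<ge> 0" for m u
    using assms by (auto simp: W_fun_def set_lebesgue_integral_def intro!: mult_nonneg_nonneg integral_nonneg)
  have "(\<Sum>j\<in>{k}. real (k choose j) * W_fun \<alpha> (k - j) (z - real j)) \<le> jump_profile \<alpha> k z"
    unfolding jump_profile_def by (intro sum_mono2 mult_nonneg_nonneg W) auto
  then show ?thesis by (simp add: W_fun_def)
qed

text \<open>The condition \<open>M\<^sub>n >> s\<^sub>n\<close> in the form in which the Chernoff bound uses it: with \<open>ln (M\<^sub>n)\<close> in place of
  \<open>ln n\<close>, so that thresholds growing faster than every power of \<open>n\<close> are covered.\<close>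

locale censoring_threshold = heavy_tailed_iid +
  fixes M :: "nat \<Rightarrow> real"
  assumes M_top: "filterlim M at_top sequentially"
    and M_log: "(\<lambda>n. real n * ln (M n) / (M n)\<^sup>2) \<longlonglongrightarrow> 0"
begin

definition Pi_seq :: "nat \<Rightarrow> real" where "Pi_seq n = real n * V (M n)"

text \<open>The scale for exponents: \<open>exp (- c lg n)\<close> is the power \<open>\<Pi>\<^sub>n\<^sup>c\<close>.\<close>

definition lg :: "nat \<Rightarrow> real" where "lg n = - ln (Pi_seq n)"

lemma M_ge: "\<forall>\<^sub>F n in sequentially. M n \<ge> c"
  using M_top by (simp add: filterlim_at_top)

lemma Pi_pos: "n \<ge> 1 \<Longrightarrow> Pi_seq n > 0"
  using V_pos by (simp add: Pi_seq_def)

lemma Pi_eq_exp: "n \<ge> 1 \<Longrightarrow> Pi_seq n = exp (- lg n)"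
  using Pi_pos by (simp add: lg_def)

lemma n_over_M2: "(\<lambda>n. real n / (M n)\<^sup>2) \<longlonglongrightarrow> 0"
proof (rule tendsto_sandwich[OF _ _ tendsto_const M_log])
  show "\<forall>\<^sub>F n in sequentially. real n / (M n)\<^sup>2 \<le> real n * ln (M n) / (M n)\<^sup>2"
    using M_ge[of "exp 1"]
  proof eventually_elim
    case (elim n)
    then have "M n > 0" by (smt (verit) exp_gt_zero)
    then have "1 \<le> ln (M n)" using elim by (simp add: ln_ge_iff)
    then have "real n * 1 \<le> real n * ln (M n)" by (intro mult_left_mono) auto
    then show ?case by (simp add: divide_right_mono)
  qed
qed simp

lemma Pi_lim: "Pi_seq \<longlonglongrightarrow> 0"
proof (rule tendsto_sandwich[OF _ _ tendsto_const n_over_M2])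
  show "\<forall>\<^sub>F n in sequentially. 0 \<le> Pi_seq n" using V_nonneg by (simp add: Pi_seq_def)
  show "\<forall>\<^sub>F n in sequentially. Pi_seq n \<le> real n / (M n)\<^sup>2"
    using M_ge[of 1]
  proof eventually_elim
    case (elim n)
    then have "real n * V (M n) \<le> real n * (1 / (M n)\<^sup>2)" by (intro mult_left_mono V_Markov) auto
    then show ?case by (simp add: Pi_seq_def)
  qed
qed

lemma lg_top: "filterlim lg at_top sequentially"
proof -
  have "filterlim Pi_seq (at_right 0) sequentially"
    unfolding filterlim_at
  proof
    show "\<forall>\<^sub>F n in sequentially. Pi_seq n \<in> {0<..} \<and> Pi_seq n \<noteq> 0"
      using eventually_ge_at_top[of 1] by eventually_elim (simp add: Pi_pos less_imp_neq[symmetric])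
  qed (rule Pi_lim)
  then have "filterlim (\<lambda>n. ln (Pi_seq n)) at_bot sequentially" by (rule filterlim_compose[OF ln_at_0])
  then show ?thesis unfolding lg_def by (simp add: filterlim_uminus_at_top)
qed

text \<open>The tail decays at most polynomially.\<close>

lemma lg_le_log_M:
  obtains c where "\<forall>\<^sub>F n in sequentially. lg n \<le> c * ln (M n)"
proof -
  obtain C t0 g where C: "C > 0" "t0 > 0" and
    pot: "\<And>s t. t0 \<le> s \<Longrightarrow> s \<le> t \<Longrightarrow> V s \<le> C * (t / s) ^ g * V t"
    using polynomial_tail_comparison[OF V_antimono V_pos V_ratio[of 2]] by auto
  define K where "K = ln (C / V t0) - real g * ln t0"
  have "\<forall>\<^sub>F n in sequentially. lg n \<le> (\<bar>K\<bar> + real g) * ln (M n)"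
    using M_ge[of "exp 1"] M_ge[of t0] eventually_ge_at_top[of 1]
  proof eventually_elim
    case (elim n)
    have pos: "M n > 0" using C elim by linarith
    have l1: "ln (M n) \<ge> 1" using elim pos by (simp add: ln_ge_iff)
    have "lg n \<le> - ln (V (M n))"
    proof -
      have "1 * V (M n) \<le> Pi_seq n" unfolding Pi_seq_def using elim V_nonneg by (intro mult_right_mono) auto
      then show ?thesis using V_pos[of "M n"] by (simp add: lg_def)
    qed
    also have "\<dots> = ln (1 / V (M n))" using V_pos[of "M n"] by (simp add: ln_div)
    also have "\<dots> \<le> ln (C / V t0 * (M n / t0) ^ g)"
      using pot[of t0 "M n"] elim V_pos[of "M n"] V_pos[of t0] C pos
      by (subst ln_le_cancel_iff) (auto simp: field_simps)
    also have "\<dots> = K + real g * ln (M n)"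
      using C pos V_pos[of t0] by (simp add: K_def ln_mult ln_div ln_realpow algebra_simps)
    also have "\<dots> \<le> \<bar>K\<bar> * ln (M n) + real g * ln (M n)"
      using l1 mult_left_mono[of 1 "ln (M n)" "\<bar>K\<bar>"] by auto
    finally show ?case by (simp add: distrib_right)
  qed
  then show ?thesis using that by blast
qed

lemma n_lg_over_M2: "(\<lambda>n. real n * lg n / (M n)\<^sup>2) \<longlonglongrightarrow> 0"
  and lg_over_M: "(\<lambda>n. lg n / M n) \<longlonglongrightarrow> 0"
proof -
  obtain c where c: "\<forall>\<^sub>F n in sequentially. lg n \<le> c * ln (M n)" by (rule lg_le_log_M)
  have lg0: "\<forall>\<^sub>F n in sequentially. lg n \<ge> 0" using lg_top by (simp add: filterlim_at_top)
  have a: "(\<lambda>n. c * (real n * ln (M n) / (M n)\<^sup>2)) \<longlonglongrightarrow> 0"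
    using tendsto_mult_left[OF M_log, of c] by simp
  show "(\<lambda>n. real n * lg n / (M n)\<^sup>2) \<longlonglongrightarrow> 0"
  proof (rule tendsto_sandwich[OF _ _ tendsto_const a])
    show "\<forall>\<^sub>F n in sequentially. 0 \<le> real n * lg n / (M n)\<^sup>2" using lg0 by eventually_elim simp
    show "\<forall>\<^sub>F n in sequentially. real n * lg n / (M n)\<^sup>2 \<le> c * (real n * ln (M n) / (M n)\<^sup>2)"
      using c
    proof eventually_elim
      case (elim n)
      have "real n * lg n / (M n)\<^sup>2 \<le> real n * (c * ln (M n)) / (M n)\<^sup>2"
        using elim by (intro divide_right_mono mult_left_mono) auto
      then show ?case by (simp add: mult_ac)
    qed
  qed
  have b: "(\<lambda>n. c * (ln (M n) / M n)) \<longlonglongrightarrow> 0"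
    using tendsto_mult_left[OF filterlim_compose[OF ln_x_over_x_tendsto_0 M_top], of c] by simp
  show "(\<lambda>n. lg n / M n) \<longlonglongrightarrow> 0"
  proof (rule tendsto_sandwich[OF _ _ tendsto_const b])
    show "\<forall>\<^sub>F n in sequentially. 0 \<le> lg n / M n"
      using lg0 M_ge[of 1] by eventually_elim simp
    show "\<forall>\<^sub>F n in sequentially. lg n / M n \<le> c * (ln (M n) / M n)"
      using c M_ge[of 1]
    proof eventually_elim
      case (elim n)
      then have "lg n / M n \<le> c * ln (M n) / M n" by (intro divide_right_mono) auto
      then show ?case by simp
    qed
  qed
qed

text \<open>This is what the exponent in the Chernoff bound picks up from the tail.  At \<open>M n / (a lg n)\<close> the tail exceeds
  \<open>V (M n)\<close> by a factor polynomial in \<open>lg n\<close> only, which cannot compete with \<open>\<Pi>\<^sub>n exp (lg n / 2) = exp (- lg n / 2)\<close>.\<close>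

lemma large_deviation_term:
  assumes "a > 0"
  shows "(\<lambda>n. real n * exp (lg n / 2) * V (M n / (a * lg n))) \<longlonglongrightarrow> 0"
proof -
  obtain C t0 g where C: "C > 0" "t0 > 0" and
    pot: "\<And>s t. t0 \<le> s \<Longrightarrow> s \<le> t \<Longrightarrow> V s \<le> C * (t / s) ^ g * V t"
    using polynomial_tail_comparison[OF V_antimono V_pos V_ratio[of 2]] by auto
  have half: "filterlim (\<lambda>n. lg n / 2) at_top sequentially"
    using filterlim_tendsto_pos_mult_at_top[OF tendsto_const _ lg_top, of "1/2"] by simp
  have "(\<lambda>n. C * (2 * a) ^ g * ((lg n / 2) ^ g / exp (lg n / 2))) \<longlonglongrightarrow> C * (2 * a) ^ g * 0"
    by (intro tendsto_intros filterlim_compose[OF tendsto_power_div_exp_0 half])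
  then have lim: "(\<lambda>n. C * (2 * a) ^ g * ((lg n / 2) ^ g / exp (lg n / 2))) \<longlonglongrightarrow> 0" by simp
  have e1: "\<forall>\<^sub>F n in sequentially. a * t0 * (lg n / M n) < 1"
    using order_tendstoD(2)[OF tendsto_mult_left[OF lg_over_M, of "a * t0"], of 1] by simp
  have e2: "\<forall>\<^sub>F n in sequentially. lg n \<ge> 1 / a"
    using lg_top by (simp add: filterlim_at_top)
  show ?thesis
  proof (rule tendsto_sandwich[OF _ _ tendsto_const lim])
    show "\<forall>\<^sub>F n in sequentially. 0 \<le> real n * exp (lg n / 2) * V (M n / (a * lg n))"
      using V_nonneg by simp
    show "\<forall>\<^sub>F n in sequentially. real n * exp (lg n / 2) * V (M n / (a * lg n))
        \<le> C * (2 * a) ^ g * ((lg n / 2) ^ g / exp (lg n / 2))"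
      using e1 e2 M_ge[of 1] eventually_ge_at_top[of 1]
    proof eventually_elim
      case (elim n)
      have "1 / a > 0" using assms by simp
      then have lpos: "lg n > 0" using elim(2) by linarith
      have al: "a * lg n \<ge> 1" using mult_left_mono[OF elim(2), of a] assms by simp
      have "V (M n / (a * lg n)) \<le> C * (M n / (M n / (a * lg n))) ^ g * V (M n)"
      proof (rule pot)
        have "a * t0 * lg n / M n < 1" using elim(1) by simp
        then have "t0 * (a * lg n) \<le> M n" using elim(3) by (simp add: pos_divide_less_eq mult_ac)
        moreover have "a * lg n > 0" using al by linarith
        ultimately show "t0 \<le> M n / (a * lg n)" by (simp only: pos_le_divide_eq)
        have "M n * 1 \<le> M n * (a * lg n)" using elim(3) al by (intro mult_left_mono) auto
        moreover have "a * lg n > 0" using al by linarith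
        ultimately show "M n / (a * lg n) \<le> M n" by (simp only: pos_divide_le_eq mult_1_right)
      qed
      also have "M n / (M n / (a * lg n)) = a * lg n" using elim(3) by simp
      finally have "real n * exp (lg n / 2) * V (M n / (a * lg n))
          \<le> real n * exp (lg n / 2) * (C * (a * lg n) ^ g * V (M n))"
        by (intro mult_left_mono) auto
      also have "\<dots> = C * (a * lg n) ^ g * exp (lg n / 2) * Pi_seq n" by (simp add: Pi_seq_def)
      also have "\<dots> = C * (a * lg n) ^ g * (exp (lg n / 2) * exp (- lg n))"
        using Pi_eq_exp[OF elim(4)] by simp
      also have "exp (lg n / 2) * exp (- lg n) = 1 / exp (lg n / 2)"
      proof -
        have "exp (lg n / 2) * exp (- lg n) = exp (- (lg n / 2))" by (simp add: exp_add[symmetric])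
        then show ?thesis by (simp add: exp_minus inverse_eq_divide)
      qed
      also have "(a * lg n) ^ g = (2 * a) ^ g * (lg n / 2) ^ g"
        by (simp only: power_mult_distrib[symmetric]) simp
      finally show ?case by (simp only: mult.assoc times_divide_eq_right mult_1_right)
    qed
  qed
qed

text \<open>Chernoff's bound with \<open>r = a \<ell> / M n\<close>, where \<open>\<ell> = - ln \<Pi>\<^sub>n\<close>.  With \<open>a e = k + 1\<close> the leading factor
  \<open>exp (- r e M n)\<close> is \<open>\<Pi>\<^sub>n\<^sup>k\<^sup>+\<^sup>1\<close>, one power of \<open>\<Pi>\<^sub>n\<close> more than needed.  The Gaussian part \<open>n r\<^sup>2\<close> of the exponent is
  \<open>o(\<ell>)\<close>, because \<open>n \<ell> / (M n)\<^sup>2\<close> tends to \<open>0\<close>, and the part coming from the tail is \<open>O(1)\<close> if \<open>a d \<le> 1/2\<close>,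
  because \<open>exp (\<ell> / 2)\<close> costs only half a power of \<open>\<Pi>\<^sub>n\<close>.\<close>

lemma few_jumps_negligible:
  assumes "e > 0"
  obtains d0 where "d0 > 0" "\<And>d. 0 < d \<Longrightarrow> d \<le> d0 \<Longrightarrow>
    (\<lambda>n. prob {\<omega> \<in> space P. (\<Sum>j=1..n. if \<xi> j \<omega> \<le> d * M n then \<xi> j \<omega> else 0) > e * M n} / Pi_seq n ^ k) \<longlonglongrightarrow> 0"
proof -
  \<comment> \<open>\<open>k\<close> powers of \<open>\<Pi>\<^sub>n\<close> are divided out, and one is left over to beat the error terms.\<close>
  define a where "a = (real k + 1) / e"
  have a: "a > 0" "a * e = real k + 1" using assms by (auto simp: a_def)
  show ?thesis
  proof (rule that)
    show "1 / (2 * a) > 0" using a by simp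
    fix d :: real assume d: "0 < d" "d \<le> 1 / (2 * a)"
    have ad: "a * d \<le> 1 / 2" using d a by (simp add: field_simps)
    have half: "filterlim (\<lambda>n. - 1 + lg n / 2) at_top sequentially"
      by (intro filterlim_tendsto_add_at_top[OF tendsto_const])
         (use filterlim_tendsto_pos_mult_at_top[OF tendsto_const _ lg_top, of "1/2"] in simp)
    have "(\<lambda>n. exp (- (- 1 + lg n / 2))) \<longlonglongrightarrow> 0"
      by (rule filterlim_compose[OF exp_at_bot]) (use half in \<open>simp only: filterlim_uminus_at_top[symmetric]\<close>)
    then have lim: "(\<lambda>n. exp (1 - lg n / 2)) \<longlonglongrightarrow> 0" by (simp add: algebra_simps)
    have e1: "\<forall>\<^sub>F n in sequentially. real n * lg n / (M n)\<^sup>2 < 1 / (2 * a\<^sup>2)"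
      using a by (intro order_tendstoD(2)[OF n_lg_over_M2]) auto
    have e2: "\<forall>\<^sub>F n in sequentially. real n * exp (lg n / 2) * V (M n / (a * lg n)) < 1"
      using order_tendstoD(2)[OF large_deviation_term[OF a(1)]] by simp
    have e3: "\<forall>\<^sub>F n in sequentially. lg n \<ge> 1" using lg_top by (simp add: filterlim_at_top)
    show "(\<lambda>n. prob {\<omega> \<in> space P. (\<Sum>j=1..n. if \<xi> j \<omega> \<le> d * M n then \<xi> j \<omega> else 0) > e * M n} / Pi_seq n ^ k) \<longlonglongrightarrow> 0"
    proof (rule tendsto_sandwich[OF _ _ tendsto_const lim])
      show "\<forall>\<^sub>F n in sequentially. 0 \<le> prob {\<omega> \<in> space P. (\<Sum>j=1..n. if \<xi> j \<omega> \<le> d * M n then \<xi> j \<omega> else 0) > e * M n} / Pi_seq n ^ k"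
        using eventually_ge_at_top[of 1] by eventually_elim (use Pi_pos less_imp_le in \<open>auto intro!: divide_nonneg_nonneg zero_le_power\<close>)
      show "\<forall>\<^sub>F n in sequentially. prob {\<omega> \<in> space P. (\<Sum>j=1..n. if \<xi> j \<omega> \<le> d * M n then \<xi> j \<omega> else 0) > e * M n} / Pi_seq n ^ k
          \<le> exp (1 - lg n / 2)"
        using e1 e2 e3 M_ge[of 1] eventually_ge_at_top[of 1]
      proof eventually_elim
        case (elim n)
        let ?r = "a * lg n / M n"
        have r: "?r > 0" using a elim by simp
        have "exp (?r * (d * M n)) \<le> exp (lg n / 2)"
          using elim mult_right_mono[OF ad, of "lg n"] by (simp add: mult_ac)
        then have "real n * (exp (?r * (d * M n)) * V (1 / ?r)) \<le> real n * (exp (lg n / 2) * V (1 / ?r))"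
          using V_nonneg by (intro mult_left_mono mult_right_mono) auto
        also have "\<dots> < 1" using elim(2) by (simp add: mult.assoc)
        finally have t1: "real n * (exp (?r * (d * M n)) * V (1 / ?r)) \<le> 1" by simp
        have "real n * ?r\<^sup>2 = a\<^sup>2 * (real n * lg n / (M n)\<^sup>2) * lg n"
          by (simp add: power_divide power_mult_distrib power2_eq_square)
        also have "\<dots> \<le> a\<^sup>2 * (1 / (2 * a\<^sup>2)) * lg n"
          using elim by (intro mult_right_mono mult_left_mono) auto
        also have "\<dots> = lg n / 2" using a by simp
        finally have t2: "real n * ?r\<^sup>2 \<le> lg n / 2" .
        have t3: "- ?r * (e * M n) = - (real k + 1) * lg n"
          using elim a(2) by (simp add: mult_ac flip: a(2))
        have "prob {\<omega> \<in> space P. (\<Sum>j=1..n. if \<xi> j \<omega> \<le> d * M n then \<xi> j \<omega> else 0) > e * M n}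
           \<le> exp (- ?r * (e * M n) + real n * (?r\<^sup>2 + exp (?r * (d * M n)) * V (1 / ?r)))"
          using r d elim by (intro truncated_sum_Chernoff) auto
        also have "\<dots> \<le> exp (- (real k + 1) * lg n + (lg n / 2 + 1))"
          unfolding t3 using t1 t2 by (simp add: distrib_left)
        also have "\<dots> = exp (1 - lg n / 2) * exp (- lg n) ^ k"
          by (simp add: exp_of_nat_mult[symmetric] exp_add[symmetric] algebra_simps)
        also have "exp (- lg n) ^ k = Pi_seq n ^ k" using Pi_eq_exp elim by simp
        finally show ?case using Pi_pos elim by (simp add: pos_divide_le_eq)
      qed
    qed
  qed
qed

text \<open>The two-sided bounds converge to the profile at \<open>z - b\<close> and at \<open>z + b\<close>; the slack \<open>b\<close> is then removed by
  continuity.\<close>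

lemma prob_censored_pointwise:
  assumes k: "k \<ge> 1" and z: "real k - 1 < z" "z < real k"
  shows "(\<lambda>n. prob {\<omega> \<in> space P. (\<Sum>j=1..n. min (\<xi> j \<omega>) (M n)) > z * M n} * fact k / Pi_seq n ^ k)
    \<longlonglongrightarrow> jump_profile \<alpha> k z"
proof (rule LIMSEQ_I)
  fix e :: real assume "e > 0"
  have a: "\<alpha> > 0" using alpha by simp
  let ?F = "\<lambda>n. prob {\<omega> \<in> space P. (\<Sum>j=1..n. min (\<xi> j \<omega>) (M n)) > z * M n} * fact k / Pi_seq n ^ k"
  have "isCont (jump_profile \<alpha> k) z"
    using continuous_on_jump_profile[OF a, of k] z
    by (simp add: continuous_on_eq_continuous_at[OF open_greaterThanLessThan])
  then obtain r where r: "r > 0" and rG: "\<And>u. \<bar>u - z\<bar> < r \<Longrightarrow> \<bar>jump_profile \<alpha> k u - jump_profile \<alpha> k z\<bar> < e"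
    using \<open>e > 0\<close> unfolding continuous_at_eps_delta dist_real_def by metis
  \<comment> \<open>\<open>z - b\<close> and \<open>z + b\<close> must stay inside \<open>(k - 1, k)\<close> as well as in the range around \<open>z\<close> where the profile varies by less than \<open>e\<close>.\<close>
  define b where "b = min (r / 2) (min ((z - (real k - 1)) / 2) ((real k - z) / 2))"
  have b: "b > 0" "b < r" "real k - 1 < z - b" "z + b < real k"
    using r z by (auto simp: b_def min_def field_simps)
  obtain d0 where d0: "d0 > 0" and few: "\<And>d. 0 < d \<Longrightarrow> d \<le> d0 \<Longrightarrow>
    (\<lambda>n. prob {\<omega> \<in> space P. (\<Sum>j=1..n. if \<xi> j \<omega> \<le> d * M n then \<xi> j \<omega> else 0) > (z - (real k - 1)) * M n} / Pi_seq n ^ k) \<longlonglongrightarrow> 0"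
    using few_jumps_negligible[of "z - (real k - 1)" k] z by auto
  \<comment> \<open>Small enough for the small summands to be negligible and for the profile at \<open>z - b\<close> to be blind to the cut-off.\<close>
  define d where "d = min d0 (min (1 / 2) ((z - b - (real k - 1)) / 2))"
  have d: "0 < d" "d \<le> d0" "d < 1" "real k - 1 + d < z - b"
    using d0 b by (auto simp: d_def min_def field_simps)
  define \<rho> where "\<rho> n = V (d * M n) / V (M n)" for n
  define S where "S n u = measure (sum_law k (excess_law (M n) d)) {u<..}" for n u
  define q where "q n = real n / (b * M n)\<^sup>2" for n
  define c where "c m n = real (n choose m) / real n ^ m" for m n
  have \<rho>: "\<rho> \<longlonglongrightarrow> d powr (- \<alpha>)"
    using filterlim_compose[OF V_ratio[OF d(1)] M_top] unfolding \<rho>_def by (simp add: mult.commute)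
  have q: "q \<longlonglongrightarrow> 0"
    using tendsto_mult_left[OF n_over_M2, of "1 / b\<^sup>2"] unfolding q_def by (simp add: power_mult_distrib)
  have c: "c m \<longlonglongrightarrow> 1 / fact m" for m
    unfolding c_def by (rule binomial_over_power_limit)
  have S: "(\<lambda>n. S n u) \<longlonglongrightarrow> jump_profile \<alpha> k u * (d powr \<alpha>) ^ k"
    if "real k - 1 + d < u" "u < real k" for u
  proof -
    have "u \<notin> \<int>" using that d by (intro between_consecutive_not_Ints[of k]) auto
    then have "(\<lambda>n. S n u) \<longlonglongrightarrow> measure (sum_law k (pareto_clipped \<alpha> d)) {u<..}"
      unfolding S_def by (intro big_jump_sum_limit M_top d)
    then show ?thesis using jump_profile_eq_pareto_sum[OF a d(1,3) that] d by simp
  qed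
  have cancel: "fact k * (1 / fact k) * (d powr (- \<alpha>)) ^ k * (y * (d powr \<alpha>) ^ k) = y" for y :: real
    using d by (simp add: power_mult_distrib[symmetric] powr_minus)
  have Vd: "real (n choose m) * V (d * M n) ^ m = c m n * \<rho> n ^ m * Pi_seq n ^ m" if "n \<ge> 1" for n m
    using that V_pos[of "M n"] by (simp add: c_def \<rho>_def Pi_seq_def power_mult_distrib power_divide)
  have nV: "real n * V (d * M n) = \<rho> n * Pi_seq n" for n
    using V_pos[of "M n"] by (simp add: \<rho>_def Pi_seq_def)

  let ?few = "\<lambda>n. prob {\<omega> \<in> space P. (\<Sum>j=1..n. if \<xi> j \<omega> \<le> d * M n then \<xi> j \<omega> else 0) > (z - (real k - 1)) * M n} / Pi_seq n ^ k"
  \<comment> \<open>The two bounds, divided by \<open>\<Pi>\<^sub>n\<^sup>k / k!\<close>.\<close>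
  let ?U = "\<lambda>n. fact k * ?few n + fact k * (c (Suc k) n * \<rho> n ^ Suc k * Pi_seq n)
     + fact k * c k n * \<rho> n ^ k * (S n (z - b) + q n)"
  let ?Lo = "\<lambda>n. fact k * c k n * \<rho> n ^ k * S n (z + b) * (1 - \<rho> n * Pi_seq n - q n)"
  have "?U \<longlonglongrightarrow> fact k * 0 + fact k * (1 / fact (Suc k) * (d powr (- \<alpha>)) ^ Suc k * 0)
     + fact k * (1 / fact k) * (d powr (- \<alpha>)) ^ k * (jump_profile \<alpha> k (z - b) * (d powr \<alpha>) ^ k + 0)"
    using d b by (intro tendsto_intros few \<rho> q c S Pi_lim) auto
  then have U: "?U \<longlonglongrightarrow> jump_profile \<alpha> k (z - b)" by (simp only: cancel mult_zero_right add_0_right add_0_left)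
  have "?Lo \<longlonglongrightarrow> fact k * (1 / fact k) * (d powr (- \<alpha>)) ^ k * (jump_profile \<alpha> k (z + b) * (d powr \<alpha>) ^ k)
      * (1 - d powr (- \<alpha>) * 0 - 0)"
    using d b by (intro tendsto_intros \<rho> q c S Pi_lim) auto
  then have Lo: "?Lo \<longlonglongrightarrow> jump_profile \<alpha> k (z + b)" unfolding cancel by simp

  have "jump_profile \<alpha> k (z - b) < jump_profile \<alpha> k z + e" "jump_profile \<alpha> k (z + b) > jump_profile \<alpha> k z - e"
    using rG[of "z - b"] rG[of "z + b"] b by (auto simp: abs_less_iff)
  then have "\<forall>\<^sub>F n in sequentially. ?U n < jump_profile \<alpha> k z + e"
    "\<forall>\<^sub>F n in sequentially. ?Lo n > jump_profile \<alpha> k z - e"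
    using order_tendstoD(2)[OF U] order_tendstoD(1)[OF Lo] by auto
  then have "\<forall>\<^sub>F n in sequentially. norm (?F n - jump_profile \<alpha> k z) < e"
    using M_ge[of 1] eventually_ge_at_top[of 1]
  proof eventually_elim
    case (elim n)
    have Pp: "Pi_seq n > 0" using elim by (intro Pi_pos)
    have Mp: "M n > 0" using elim by simp
    have "?F n \<le> ?U n"
    proof -
      have "prob {\<omega> \<in> space P. (\<Sum>j=1..n. min (\<xi> j \<omega>) (M n)) > z * M n}
        \<le> ?few n * Pi_seq n ^ k + c (Suc k) n * \<rho> n ^ Suc k * Pi_seq n ^ Suc k
          + c k n * \<rho> n ^ k * Pi_seq n ^ k * (S n (z - b) + q n)"
        using prob_censored_sum_le[OF Mp d(1) b(1) k, where n=n and z=z] Pp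
        by (simp only: Vd[OF elim(4)] mult.assoc[symmetric] S_def q_def) simp
      then have "?F n \<le> (?few n * Pi_seq n ^ k + c (Suc k) n * \<rho> n ^ Suc k * Pi_seq n ^ Suc k
          + c k n * \<rho> n ^ k * Pi_seq n ^ k * (S n (z - b) + q n)) * fact k / Pi_seq n ^ k"
        using Pp by (intro divide_right_mono mult_right_mono) auto
      also have "\<dots> = ?U n"
      proof -
        have "(A * p + B * (x * p) + C * p * D) * f / p = f * A + f * (B * x) + f * C * D"
          if "p \<noteq> 0" for A B C D f p x :: real
          using that by (simp add: field_simps)
        from this[of "Pi_seq n ^ k" "?few n" "c (Suc k) n * \<rho> n ^ Suc k" "Pi_seq n"
            "c k n * \<rho> n ^ k" "S n (z - b) + q n" "fact k"]
        show ?thesis using Pp by (simp add: mult.assoc)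
      qed
      finally show ?thesis .
    qed
    moreover have "?Lo n \<le> ?F n"
    proof -
      have "c k n * \<rho> n ^ k * Pi_seq n ^ k * S n (z + b) * (1 - \<rho> n * Pi_seq n - q n)
        \<le> prob {\<omega> \<in> space P. (\<Sum>j=1..n. min (\<xi> j \<omega>) (M n)) > z * M n}"
        using prob_censored_sum_ge[OF Mp d(1) _ b(1), where n=n and k=k and z=z] d
        by (simp only: Vd[OF elim(4)] nV mult.assoc[symmetric] S_def q_def)
      then have "c k n * \<rho> n ^ k * Pi_seq n ^ k * S n (z + b) * (1 - \<rho> n * Pi_seq n - q n) * fact k / Pi_seq n ^ k
        \<le> ?F n"
        using Pp by (intro divide_right_mono mult_right_mono) auto
      moreover have "c k n * \<rho> n ^ k * Pi_seq n ^ k * S n (z + b) * (1 - \<rho> n * Pi_seq n - q n) * fact k / Pi_seq n ^ k = ?Lo n"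
        using Pp by (simp add: mult_ac)
      ultimately show ?thesis by simp
    qed
    ultimately show ?case using elim(1,2) unfolding real_norm_def by linarith
  qed
  then show "\<exists>no. \<forall>n\<ge>no. norm (?F n - jump_profile \<alpha> k z) < e"
    by (simp add: eventually_sequentially)
qed

lemma prob_censored_uniform:
  assumes k: "k \<ge> 1" and "e > 0"
  shows "\<forall>\<^sub>F n in sequentially. \<forall>x\<in>{(real k - 1 + e) * M n <..< (real k - e) * M n}.
    \<bar>prob {\<omega> \<in> space P. (\<Sum>j=1..n. min (\<xi> j \<omega>) (M n)) > x} /
      (Pi_seq n ^ k / fact k * jump_profile \<alpha> k (x / M n)) - 1\<bar> \<le> e"
proof (cases "e < 1 / 2")
  case False
  then have "\<forall>\<^sub>F n in sequentially. {(real k - 1 + e) * M n <..< (real k - e) * M n} = {}"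
    using M_ge[of 1] by (auto elim!: eventually_mono intro!: mult_right_mono)
  then show ?thesis by eventually_elim simp
next
  case True
  have a: "\<alpha> > 0" using alpha by simp
  let ?F = "\<lambda>n z. prob {\<omega> \<in> space P. (\<Sum>j=1..n. min (\<xi> j \<omega>) (M n)) > z * M n} * fact k / Pi_seq n ^ k"
  have "uniform_limit {real k - 1 + e..real k - e} ?F (jump_profile \<alpha> k) sequentially"
  proof (rule antimono_pointwise_imp_uniform_limit)
    show "\<forall>\<^sub>F n in sequentially. antimono (?F n)"
      using M_ge[of 1] eventually_ge_at_top[of 1]
    proof eventually_elim
      case (elim n)
      show ?case
      proof (rule antimonoI)
        fix u v :: real assume "u \<le> v"
        then have "u * M n \<le> v * M n" using elim by (intro mult_right_mono) auto
        then show "?F n v \<le> ?F n u"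
          using Pi_pos[OF elim(2)] by (intro divide_right_mono mult_right_mono finite_measure_mono) auto
      qed
    qed
    show "(\<lambda>n. ?F n z) \<longlonglongrightarrow> jump_profile \<alpha> k z" if "z \<in> {real k - 1 + e..real k - e}" for z
      using that \<open>e > 0\<close> by (intro prob_censored_pointwise k) auto
    show "continuous_on {real k - 1 + e..real k - e} (jump_profile \<alpha> k)"
      using \<open>e > 0\<close> by (intro continuous_on_subset[OF continuous_on_jump_profile[OF a, of k]]) auto
  qed (use True in simp)
  from uniform_limitD[OF this \<open>e > 0\<close>] show ?thesis
    using M_ge[of 1] eventually_ge_at_top[of 1]
  proof eventually_elim
    case (elim n)
    show ?case
    proof
      fix x assume x: "x \<in> {(real k - 1 + e) * M n <..< (real k - e) * M n}"
      let ?z = "x / M n" and ?G = "jump_profile \<alpha> k (x / M n)"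
      have Mp: "M n > 0" using elim by simp
      have "?z \<in> {real k - 1 + e..real k - e}" using x Mp by (auto simp: field_simps)
      from bspec[OF elim(1) this] have close: "\<bar>?F n ?z - ?G\<bar> < e" by (simp only: dist_real_def)
      have G: "?G \<ge> 1" by (rule jump_profile_ge_1[OF a])
      have "prob {\<omega> \<in> space P. (\<Sum>j=1..n. min (\<xi> j \<omega>) (M n)) > x} / (Pi_seq n ^ k / fact k * ?G) - 1
          = (?F n ?z - ?G) / ?G"
        using Mp G by (simp add: diff_divide_distrib)
      moreover have "\<bar>(?F n ?z - ?G) / ?G\<bar> \<le> \<bar>?F n ?z - ?G\<bar> / 1"
        using G unfolding abs_divide by (intro divide_left_mono) auto
      ultimately show "\<bar>prob {\<omega> \<in> space P. (\<Sum>j=1..n. min (\<xi> j \<omega>) (M n)) > x} /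
        (Pi_seq n ^ k / fact k * ?G) - 1\<bar> \<le> e" using close by (simp only: div_by_1)
    qed
  qed
qed

end

theorem theorem3:
  fixes P :: "'a measure" and \<xi> :: "nat \<Rightarrow> 'a \<Rightarrow> real"  \<comment> \<open>\<open>\<xi> 0\<close> is the generic variable, \<open>\<xi> 1, \<xi> 2, \<dots>\<close> the summands\<close>
    and L :: "real \<Rightarrow> real" and \<alpha> :: real and M :: "nat \<Rightarrow> real" and k :: nat
  assumes "prob_space P"
    and "prob_space.indep_vars P (\<lambda>_. borel) \<xi> UNIV"
    and "\<And>j. distr P borel (\<xi> j) = distr P borel (\<xi> 0)"
    and "integrable P (\<xi> 0)" and "(LINT \<omega>|P. \<xi> 0 \<omega>) = 0"
    and "integrable P (\<lambda>\<omega>. (\<xi> 0 \<omega>)\<^sup>2)" and "(LINT \<omega>|P. (\<xi> 0 \<omega>)\<^sup>2) = 1"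
    and "\<alpha> > 2" and "slowly_varying L"
    and "\<And>t. t > 0 \<Longrightarrow> right_tail P (\<xi> 0) t = t powr (- \<alpha>) * L t"
    and "dominates M (s_seq \<alpha>)"
    and "k \<ge> 2"
  shows "\<exists>h :: nat \<Rightarrow> real. (\<forall>n\<ge>1. h n > 0) \<and> h \<longlonglongrightarrow> 0 \<and>
    unif_equiv
      (\<lambda>n x. measure P {\<omega> \<in> space P. censored_sum \<xi> M n \<omega> > x})
      (\<lambda>n x. (real n * right_tail P (\<xi> 0) (M n)) ^ k / fact k *
              (\<Sum>j=0..k. real (k choose j) * W_fun \<alpha> (k - j) (x / M n - real j)))
      (\<lambda>n. {(real k - 1 + h n) * M n <..< (real k - h n) * M n})"
proof -
  interpret prob_space P by fact
  interpret heavy_tailed_iid P \<xi> L \<alpha> by unfold_locales (fact assms)+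
  interpret censoring_threshold P \<xi> L \<alpha> M
    by unfold_locales (use dominates_s_seq_growth[OF assms(11,8)] in auto)
  let ?f = "\<lambda>n x. measure P {\<omega> \<in> space P. censored_sum \<xi> M n \<omega> > x}"
  let ?g = "\<lambda>n x. (real n * right_tail P (\<xi> 0) (M n)) ^ k / fact k *
              (\<Sum>j=0..k. real (k choose j) * W_fun \<alpha> (k - j) (x / M n - real j))"
  let ?I = "\<lambda>e n. {(real k - 1 + e) * M n <..< (real k - e) * M n}"
  have "\<forall>\<^sub>F n in sequentially. \<forall>x\<in>?I e n. \<bar>?f n x / ?g n x - 1\<bar> \<le> e" if "e > 0" for e
    using prob_censored_uniform[OF _ that, of k] \<open>k \<ge> 2\<close>
    by (simp add: censored_sum_def Pi_seq_def jump_profile_def)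
  then obtain h :: "nat \<Rightarrow> real" where h: "\<And>n. h n > 0" "h \<longlonglongrightarrow> 0"
    and ev: "\<forall>\<^sub>F n in sequentially. \<forall>x\<in>?I (h n) n. \<bar>?f n x / ?g n x - 1\<bar> \<le> h n"
    using slowly_vanishing_parameter[of "\<lambda>e n. \<forall>x\<in>?I e n. \<bar>?f n x / ?g n x - 1\<bar> \<le> e"] by blast
  have h': "(\<lambda>n. ennreal (h n)) \<longlonglongrightarrow> 0" using tendsto_ennrealI[OF h(2)] by simp
  have "unif_equiv ?f ?g (\<lambda>n. ?I (h n) n)"
    unfolding unif_equiv_def
  proof (rule tendsto_sandwich[OF _ _ tendsto_const h'])
    show "\<forall>\<^sub>F n in sequentially. (SUP x\<in>?I (h n) n. ennreal \<bar>?f n x / ?g n x - 1\<bar>) \<le> ennreal (h n)"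
      using ev by eventually_elim (auto intro!: SUP_least ennreal_leI)
  qed simp
  then show ?thesis using h by blast
qed

end
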